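(* Let $n\ge 4$ and let $M$ be the set of (isomorphism classes of) connected multigraphs without loops on $n$ vertices containing exactly one cycle (the cycle may consist of only two vertices joined by two parallel edges). Let $\Gamma_1$ be the graph on 4 vertices consisting of a triangle together with one further edge joining a vertex of the triangle to the fourth vertex, and let $\Gamma_2$ be the 4-cycle. Then the families of spherical simplices generating the reflection group $D_n$ (families considered up to isometry) are in one-to-one correspondence with the graphs in $M\setminus\{\Gamma_1,\Gamma_2\}$. The correspondence is given as follows: realize the family by normal vectors $\pm f_1,\dots,\pm f_n$ which, suitably normalized, lie in $\Delta(D_n)=\{\pm h_i\pm h_j:1\le i<j\le n\}$ ($h_1,\dots,h_n$ the standard basis of $\mathbb{R}^n$); the associated graph has vertices $v_1,\dots,v_n$ corresponding to $h_1,\dots,h_n$, with an edge between $v_i$ and $v_j$ for each of $\pm(h_i+h_j)$, $\pm(h_i-h_j)$ occurring among the $f_k$ (so $v_i,v_j$ are joined by two edges if both occur).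
   Context: A family of spherical simplices in $S^{n-1}$ is the set of $2^n$ simplices cut out by $n$ hyperplanes through the origin in $\mathbb{R}^n$ with linearly independent unit normals $f_1,\dots,f_n$; it is encoded by $\pm f_1,\dots,\pm f_n$. The family generates the group generated by the reflections in the hyperplanes $f_i^\perp$; it generates $D_n$ if this group is the finite Coxeter (Weyl) group of type $D_n$ (up to conjugation by an orthogonal transformation). The graphs $\Gamma_1,\Gamma_2$ are excluded because their corresponding families coincide with those of the graphs on 4 vertices consisting of a double edge $ab$ plus the edges $ac,ad$, resp. a double edge $ab$ plus the edges $ac,bd$. *)

theory Defs
  imports "HOL-Analysis.Analysis"
begin

section \<open>Reflections and reflection groups in R^n\<close>

definition reflect :: "real^'n \<Rightarrow> real^'n \<Rightarrow> real^'n" where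
  "reflect s x = x - (2 * (x \<bullet> s) / (s \<bullet> s)) *\<^sub>R s"

text \<open>Group generated by the reflections in the hyperplanes orthogonal to the vectors of S.
  Since reflections are involutions, the monoid they generate is the group they generate.\<close>
inductive_set refl_group :: "(real^'n) set \<Rightarrow> (real^'n \<Rightarrow> real^'n) set" for S where
  refl_group_id: "id \<in> refl_group S"
| refl_group_step: "w \<in> refl_group S \<Longrightarrow> s \<in> S \<Longrightarrow> reflect s \<circ> w \<in> refl_group S"

text \<open>The root system Delta(D_n) = { +-h_i +- h_j : i < j }.\<close>
definition Delta_D :: "(real^'n) set" where
  "Delta_D = {a *\<^sub>R axis i 1 + b *\<^sub>R axis j 1 | i j a b.
                i \<noteq> j \<and> (a = 1 \<or> a = -1) \<and> (b = 1 \<or> b = -1)}"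

text \<open>The Weyl group of type D_n.\<close>
definition W_D :: "(real^'n \<Rightarrow> real^'n) set" where
  "W_D = refl_group Delta_D"

section \<open>Families of spherical simplices\<close>

text \<open>A family is encoded by unit normals f_1..f_n (indexed by 'n), linearly independent.\<close>
definition is_family :: "('n \<Rightarrow> real^'n) \<Rightarrow> bool" where
  "is_family f \<longleftrightarrow> (\<forall>i. norm (f i) = 1) \<and> inj f \<and> independent (range f)"

definition pm_set :: "('n \<Rightarrow> real^'n) \<Rightarrow> (real^'n) set" where
  "pm_set f = range f \<union> uminus ` range f"

definition generates_D :: "('n::finite \<Rightarrow> real^'n) \<Rightarrow> bool" where
  "generates_D f \<longleftrightarrow> is_family f \<and>
     (\<exists>T :: real^'n \<Rightarrow> real^'n. orthogonal_transformation T \<and> W_D = (\<lambda>w. T \<circ> w \<circ> inv T) ` refl_group (range f))"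

text \<open>Families up to isometry.\<close>
definition fam_isometric :: "('n \<Rightarrow> real^'n) \<Rightarrow> ('n \<Rightarrow> real^'n) \<Rightarrow> bool" where
  "fam_isometric f g \<longleftrightarrow> (\<exists>T. orthogonal_transformation T \<and> T ` pm_set f = pm_set g)"

text \<open>Family whose normals, suitably normalized (multiplied by sqrt 2), lie in Delta(D_n).\<close>
definition Delta_family :: "('n \<Rightarrow> real^'n) \<Rightarrow> bool" where
  "Delta_family f \<longleftrightarrow> (\<forall>k. sqrt 2 *\<^sub>R f k \<in> Delta_D)"

text \<open>Associated multigraph: vertex set 'n (v_i ~ h_i), one edge for each normal f_k,
  joining the two vertices i, j with f_k proportional to +-h_i +- h_j.\<close>
definition fam_ends :: "('n \<Rightarrow> real^'n) \<Rightarrow> 'n \<Rightarrow> 'n set" where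
  "fam_ends f k = {i. f k $ i \<noteq> 0}"

section \<open>Multigraphs\<close>

text \<open>A multigraph with vertex set UNIV::'v, edge set E, and end-point map ends.
  Loopless: every edge has exactly two distinct ends.\<close>
definition loopless_mg :: "'e set \<Rightarrow> ('e \<Rightarrow> 'v set) \<Rightarrow> bool" where
  "loopless_mg E ends \<longleftrightarrow> finite E \<and> (\<forall>e\<in>E. card (ends e) = 2)"

definition mg_adj :: "'e set \<Rightarrow> ('e \<Rightarrow> 'v set) \<Rightarrow> ('v \<times> 'v) set" where
  "mg_adj E ends = {(u, v). \<exists>e\<in>E. ends e = {u, v}}"

definition connected_mg :: "'e set \<Rightarrow> ('e \<Rightarrow> 'v set) \<Rightarrow> bool" where
  "connected_mg E ends \<longleftrightarrow> (\<forall>u v. (u, v) \<in> (mg_adj E ends)\<^sup>*)"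

text \<open>A cycle is a nonempty set C of edges forming a connected 2-regular subgraph
  (on the vertices it covers); two parallel edges form a cycle of length 2.\<close>
definition is_cycle :: "'e set \<Rightarrow> ('e \<Rightarrow> 'v set) \<Rightarrow> 'e set \<Rightarrow> bool" where
  "is_cycle E ends C \<longleftrightarrow> C \<subseteq> E \<and> C \<noteq> {} \<and>
     (\<forall>v. card {e\<in>C. v \<in> ends e} = 0 \<or> card {e\<in>C. v \<in> ends e} = 2) \<and>
     (\<forall>u\<in>\<Union>(ends ` C). \<forall>v\<in>\<Union>(ends ` C). (u, v) \<in> (mg_adj C ends)\<^sup>*)"

text \<open>The class M: connected loopless multigraphs (on the vertex set UNIV) with exactly one cycle.\<close>
definition in_M :: "'e set \<Rightarrow> ('e \<Rightarrow> 'v set) \<Rightarrow> bool" where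
  "in_M E ends \<longleftrightarrow> loopless_mg E ends \<and> connected_mg E ends \<and> (\<exists>!C. is_cycle E ends C)"

text \<open>Isomorphism of multigraphs (both on vertex set UNIV::'v).\<close>
definition mg_iso :: "'e set \<Rightarrow> ('e \<Rightarrow> 'v set) \<Rightarrow> 'f set \<Rightarrow> ('f \<Rightarrow> 'v set) \<Rightarrow> bool" where
  "mg_iso E ends E' ends' \<longleftrightarrow> (\<exists>\<sigma> \<tau>. bij \<sigma> \<and> bij_betw \<tau> E E' \<and>
      (\<forall>e\<in>E. ends' (\<tau> e) = \<sigma> ` ends e))"

text \<open>Being isomorphic to Gamma_1 (triangle plus pendant edge) resp. Gamma_2 (4-cycle).\<close>
definition is_Gamma1 :: "'e set \<Rightarrow> ('e \<Rightarrow> 'v set) \<Rightarrow> bool" where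
  "is_Gamma1 E ends \<longleftrightarrow> (\<exists>a b c d. distinct [a, b, c, d] \<and> UNIV = {a, b, c, d} \<and>
      finite E \<and> inj_on ends E \<and> ends ` E = {{a, b}, {b, c}, {a, c}, {c, d}})"

definition is_Gamma2 :: "'e set \<Rightarrow> ('e \<Rightarrow> 'v set) \<Rightarrow> bool" where
  "is_Gamma2 E ends \<longleftrightarrow> (\<exists>a b c d. distinct [a, b, c, d] \<and> UNIV = {a, b, c, d} \<and>
      finite E \<and> inj_on ends E \<and> ends ` E = {{a, b}, {b, c}, {c, d}, {d, a}})"

definition in_M' :: "'e set \<Rightarrow> ('e \<Rightarrow> 'v set) \<Rightarrow> bool" where
  "in_M' E ends \<longleftrightarrow> in_M E ends \<and> \<not> is_Gamma1 E ends \<and> \<not> is_Gamma2 E ends"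

section \<open>The correspondence\<close>

text \<open>Family f corresponds to graph (E, ends): f is isometric to a family g with normals
  in Delta(D_n) whose associated graph is isomorphic to (E, ends).\<close>
definition corresponds :: "('n \<Rightarrow> real^'n) \<Rightarrow> 'e set \<Rightarrow> ('e \<Rightarrow> 'n set) \<Rightarrow> bool" where
  "corresponds f E ends \<longleftrightarrow> (\<exists>g. fam_isometric f g \<and> is_family g \<and> Delta_family g \<and>
      mg_iso (UNIV :: 'n set) (fam_ends g) E ends)"

end

theory Submission
  imports Defs
begin

text \<open>A connected multigraph on \<open>n\<close> vertices has exactly one cycle iff it has \<open>n\<close> edges. Choosing a
  normal \<open>h\<^sub>i \<plusminus> h\<^sub>j\<close> for each edge amounts to signing the edges. Up to the isometries \<open>h\<^sub>i \<mapsto> \<plusminus>h\<^sub>i\<close>, which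
  flip the signs along a cut, there are only two classes of signings, because the cuts form a
  subgroup of index two in the power set of the edge set. If the set of edges of the form
  \<open>h\<^sub>i + h\<^sub>j\<close> is a cut, then the \<open>\<plusminus>1\<close> vector of that cut is orthogonal to all normals; otherwise
  the normals are linearly independent and their reflections generate the whole Weyl group.
  So a graph determines its family.

  Conversely, elements of the Weyl group permute the \<open>\<plusminus>h\<^sub>i\<close> and preserve the product of the
  coordinates, whence every reflection in the group comes from a root. Thus a generating family
  can be moved into the root system, and an isometry between two such families preserves the root
  system. For \<open>n \<ge> 5\<close> it is a signed permutation, since the \<open>\<plusminus>h\<^sub>i\<close> are the only unit vectors having
  integral inner products with all roots. For \<open>n = 4\<close> the three graphs with a double edge have different
  numbers of non-orthogonal pairs of normals, and reflections in \<open>(\<plusminus>1, \<plusminus>1, \<plusminus>1, \<plusminus>1)\<close> move the families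
  of the two excluded graphs to families with a double edge.\<close>

section \<open>Multigraphs with exactly one cycle\<close>

text \<open>Double counting of incidences. Closedness of \<open>U\<close> makes every edge
  contribute two or nothing, so the count also applies to unions of components.\<close>

lemma handshake:
  assumes "finite F" "\<forall>e\<in>F. card (ends e) = 2" "finite U"
    and closed: "\<forall>e\<in>F. ends e \<subseteq> U \<or> ends e \<inter> U = {}"
  shows "(\<Sum>v\<in>U. card {e\<in>F. v \<in> ends e}) = 2 * card {e\<in>F. ends e \<subseteq> U}"
proof -
  have "card {v\<in>U. v \<in> ends e} = (if ends e \<subseteq> U then 2 else 0)" if "e \<in> F" for e
  proof (cases "ends e \<subseteq> U")
    case True
    then have "{v\<in>U. v \<in> ends e} = ends e" by auto
    then show ?thesis using True assms(2) that by simp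
  next
    case False
    then have "{v\<in>U. v \<in> ends e} = {}" using closed that by blast
    then show ?thesis using False by (simp only: card.empty if_False)
  qed
  then have "(\<Sum>v\<in>U. card {e\<in>F. v \<in> ends e}) = (\<Sum>e\<in>F. if ends e \<subseteq> U then 2 else 0)"
    by (intro sum_multicount_gen assms(1,3)) auto
  also have "\<dots> = 2 * card {e\<in>F. ends e \<subseteq> U}"
    using assms(1) by (simp add: sum.If_cases Int_def)
  finally show ?thesis .
qed

section \<open>Cycles, their edges and connectedness\<close>

lemma is_cycle_subset: "is_cycle E ends C \<Longrightarrow> C \<subseteq> E"
  and is_cycle_nonempty: "is_cycle E ends C \<Longrightarrow> C \<noteq> {}"
  unfolding is_cycle_def by blast+

lemma is_cycle_finite: "loopless_mg E ends \<Longrightarrow> is_cycle E ends C \<Longrightarrow> finite C"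
  unfolding loopless_mg_def is_cycle_def by (meson finite_subset)

lemma is_cycle_degree:
  assumes "loopless_mg E ends" "is_cycle E ends C" "e \<in> C" "v \<in> ends e"
  shows "card {e\<in>C. v \<in> ends e} = 2"
proof -
  have "finite {e\<in>C. v \<in> ends e}" using is_cycle_finite[OF assms(1,2)] by simp
  moreover have "{e\<in>C. v \<in> ends e} \<noteq> {}" using assms by auto
  ultimately have "card {e\<in>C. v \<in> ends e} \<noteq> 0" by simp
  moreover have "card {e\<in>C. v \<in> ends e} = 0 \<or> card {e\<in>C. v \<in> ends e} = 2"
    using assms(2) unfolding is_cycle_def by (elim conjE) (erule spec)
  ultimately show ?thesis by (elim disjE) simp_all
qed

text \<open>At a vertex of \<open>C\<close> the two edges of \<open>C'\<close> are already the two
  edges of \<open>C\<close>, so a walk through the connected \<open>C'\<close> that starts in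
  \<open>C\<close> never leaves it.\<close>

lemma cycle_subset_eq:
  assumes E: "loopless_mg E ends" and C: "is_cycle E ends C" and C': "is_cycle E ends C'"
    and sub: "C \<subseteq> C'"
  shows "C = C'"
proof -
  have fin: "finite C'" by (rule is_cycle_finite[OF E C'])
  have mem: "e \<in> C" if e: "e \<in> C'" "x \<in> ends e" "x \<in> \<Union>(ends ` C)" for e x
  proof -
    have 1: "card {e\<in>C. x \<in> ends e} = 2" using is_cycle_degree[OF E C] e(3) by blast
    have 2: "card {e\<in>C'. x \<in> ends e} = 2" using is_cycle_degree[OF E C' e(1,2)] .
    have "{e\<in>C. x \<in> ends e} = {e\<in>C'. x \<in> ends e}"
      by (rule card_subset_eq) (use fin sub 1 2 in auto)
    then show ?thesis using e by blast
  qed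
  have two: "ends e \<noteq> {}" if "e \<in> C'" for e
    using E C' that unfolding loopless_mg_def is_cycle_def by fastforce
  obtain c where c: "c \<in> C" using C unfolding is_cycle_def by auto
  then obtain u where u: "u \<in> ends c" using two sub by blast
  have reach: "z \<in> \<Union>(ends ` C)" if "(u, z) \<in> (mg_adj C' ends)\<^sup>*" for z
    using that
  proof induction
    case base then show ?case using c u by auto
  next
    case (step y z)
    then obtain e where "e \<in> C'" "ends e = {y, z}" unfolding mg_adj_def by auto
    then show ?case using step.IH mem[of e y] by auto
  qed
  have "e \<in> C" if e: "e \<in> C'" for e
  proof -
    obtain v where v: "v \<in> ends e" using two e by blast
    have "(u, v) \<in> (mg_adj C' ends)\<^sup>*"
      using C' u v e c sub unfolding is_cycle_def by blast
    then show ?thesis using mem[OF e v] reach by blast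
  qed
  then show ?thesis using sub by blast
qed

lemma mg_adj_sym: "(u, v) \<in> mg_adj E ends \<Longrightarrow> (v, u) \<in> mg_adj E ends"
  unfolding mg_adj_def by (auto simp: insert_commute)

lemma mg_adj_rtrancl_sym: "(u, v) \<in> (mg_adj E ends)\<^sup>* \<Longrightarrow> (v, u) \<in> (mg_adj E ends)\<^sup>*"
  by (meson mg_adj_sym symI sym_rtrancl symD)

lemma mg_adj_mono: "E \<subseteq> F \<Longrightarrow> mg_adj E ends \<subseteq> mg_adj F ends"
  unfolding mg_adj_def by auto

text \<open>Supplies the closedness hypothesis of \<open>handshake\<close> for reachability classes,
  and later the coordinate supports preserved by a reflection group.\<close>

lemma mg_reach_closed:
  assumes "e \<in> E" "card (ends e) = 2"
  shows "ends e \<subseteq> {z. (x, z) \<in> (mg_adj E ends)\<^sup>*} \<or> ends e \<inter> {z. (x, z) \<in> (mg_adj E ends)\<^sup>*} = {}"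
proof -
  obtain p q where pq: "ends e = {p, q}" using assms(2) by (meson card_2_iff)
  then have "(p, q) \<in> mg_adj E ends" "(q, p) \<in> mg_adj E ends" using assms(1)
    unfolding mg_adj_def by auto
  then show ?thesis using pq by (auto intro: rtrancl_into_rtrancl)
qed

text \<open>A cycle has no bridge, by parity: if deleting \<open>e\<close> separated
  \<open>x\<close> from \<open>y\<close>, then \<open>x\<close> would be the only vertex of odd
  degree in its component.\<close>

lemma cycle_edge_reach:
  fixes ends :: "'e \<Rightarrow> 'v::finite set"
  assumes E: "loopless_mg E ends" and C: "is_cycle E ends C" and e: "e \<in> C" "ends e = {x, y}" "x \<noteq> y"
  shows "(x, y) \<in> (mg_adj (C - {e}) ends)\<^sup>*"
proof (rule ccontr)
  define U where "U = {z. (x, z) \<in> (mg_adj (C - {e}) ends)\<^sup>*}"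
  assume "\<not> ?thesis"
  then have y: "y \<notin> U" unfolding U_def by simp
  have x: "x \<in> U" unfolding U_def by simp
  have fin: "finite C" by (rule is_cycle_finite[OF E C])
  have two: "\<forall>f\<in>C. card (ends f) = 2" using E C unfolding loopless_mg_def is_cycle_def by auto
  have "(\<Sum>v\<in>U. card {f\<in>C - {e}. v \<in> ends f}) = 2 * card {f\<in>C - {e}. ends f \<subseteq> U}"
  proof (rule handshake)
    show "\<forall>f\<in>C - {e}. ends f \<subseteq> U \<or> ends f \<inter> U = {}"
    proof
      fix f assume f: "f \<in> C - {e}"
      then have "card (ends f) = 2" using two by auto
      with f show "ends f \<subseteq> U \<or> ends f \<inter> U = {}" unfolding U_def by (rule mg_reach_closed)
    qed
  qed (use fin two in auto)
  then have ev: "even (\<Sum>v\<in>U. card {f\<in>C - {e}. v \<in> ends f})" by simp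
  have "{f\<in>C - {e}. x \<in> ends f} = {f\<in>C. x \<in> ends f} - {e}" by auto
  moreover have "card {f\<in>C. x \<in> ends f} = 2" using is_cycle_degree[OF E C e(1)] e(2) by simp
  ultimately have dx: "card {f\<in>C - {e}. x \<in> ends f} = 1"
    using e fin by (simp add: card_Diff_singleton)
  \<comment> \<open>Besides \<open>x\<close>, the edge \<open>e\<close> ends only at
    \<open>y\<close>, which lies outside \<open>U\<close>, so the other vertices of \<open>U\<close>
    keep their degree in the cycle.\<close>
  have "even (card {f\<in>C - {e}. v \<in> ends f})" if "v \<in> U - {x}" for v
  proof -
    have "{f\<in>C - {e}. v \<in> ends f} = {f\<in>C. v \<in> ends f}" using that e y by auto
    then show ?thesis using C unfolding is_cycle_def by (metis even_zero dvd_refl)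
  qed
  then have "even (\<Sum>v\<in>U - {x}. card {f\<in>C - {e}. v \<in> ends f})" by (intro dvd_sum) auto
  then have "odd (\<Sum>v\<in>U. card {f\<in>C - {e}. v \<in> ends f})"
    using x dx by (subst sum.remove[of _ x]) auto
  then show False using ev by simp
qed

text \<open>Each use of the removed edge is replaced by the detour along the rest of its
  cycle.\<close>

lemma connected_remove_cycle_edge:
  fixes ends :: "'e \<Rightarrow> 'v::finite set"
  assumes E: "loopless_mg E ends" and con: "connected_mg E ends" and C: "is_cycle E ends C" and e: "e \<in> C"
  shows "connected_mg (E - {e}) ends"
proof -
  have CE: "C \<subseteq> E" using C unfolding is_cycle_def by auto
  then have "card (ends e) = 2" using E e unfolding loopless_mg_def by auto
  then obtain x y where xy: "ends e = {x, y}" "x \<noteq> y" by (meson card_2_iff)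
  have "mg_adj (C - {e}) ends \<subseteq> mg_adj (E - {e}) ends" using CE by (intro mg_adj_mono) auto
  then have r: "(x, y) \<in> (mg_adj (E - {e}) ends)\<^sup>*"
    using cycle_edge_reach[OF E C e xy] rtrancl_mono by blast
  have "mg_adj E ends \<subseteq> (mg_adj (E - {e}) ends)\<^sup>*"
  proof clarify
    fix u v assume "(u, v) \<in> mg_adj E ends"
    then obtain f where f: "f \<in> E" "ends f = {u, v}" unfolding mg_adj_def by auto
    show "(u, v) \<in> (mg_adj (E - {e}) ends)\<^sup>*"
    proof (cases "f = e")
      case True
      then have "(u, v) = (x, y) \<or> (u, v) = (y, x)" using f xy by (auto simp: doubleton_eq_iff)
      then show ?thesis using r mg_adj_rtrancl_sym[OF r] by auto
    next
      case False
      then show ?thesis using f unfolding mg_adj_def by auto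
    qed
  qed
  then have "(mg_adj E ends)\<^sup>* \<subseteq> (mg_adj (E - {e}) ends)\<^sup>*" by (rule rtrancl_subset_rtrancl)
  then show ?thesis using con unfolding connected_mg_def by blast
qed

lemma is_cycle_subset_iff: "F \<subseteq> E \<Longrightarrow> is_cycle F ends C \<longleftrightarrow> is_cycle E ends C \<and> C \<subseteq> F"
  unfolding is_cycle_def by auto

text \<open>A smallest nonempty edge set covering at most as many vertices as it has edges is a
  cycle. By minimality both numbers agree and no vertex is a leaf; the handshake count then forces
  all degrees to be two, and a disconnected set would have a smaller part with the same
  property.\<close>

lemma ex_cycle:
  fixes ends :: "'e \<Rightarrow> 'v::finite set"
  assumes E: "loopless_mg E ends" and card: "card E \<ge> CARD('v)"
  shows "\<exists>C. is_cycle E ends C"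
proof -
  define V where "V F = \<Union>(ends ` F)" for F
  define P where "P F \<longleftrightarrow> F \<subseteq> E \<and> F \<noteq> {} \<and> card (V F) \<le> card F" for F
  have finE: "finite E" using E unfolding loopless_mg_def by auto
  have "card (V E) \<le> card E" using card card_mono[of UNIV "V E"] by (simp add: le_trans)
  moreover have "E \<noteq> {}" using card by (metis card.empty not_one_le_zero zero_less_card_finite le_zero_eq less_irrefl)
  ultimately have "P E" unfolding P_def by auto
  then have "\<exists>F. P F \<and> (\<forall>F'. P F' \<longrightarrow> card F \<le> card F')" using ex_has_least_nat[of P _ card] by blast
  then obtain F where F: "P F" and min: "\<And>F'. P F' \<Longrightarrow> card F \<le> card F'" by blast
  have FE: "F \<subseteq> E" "F \<noteq> {}" and cF: "card (V F) \<le> card F" using F unfolding P_def by auto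
  have finF: "finite F" using FE finE finite_subset by blast
  have two: "\<forall>e\<in>F. card (ends e) = 2" using E FE unfolding loopless_mg_def by auto
  \<comment> \<open>The form in which minimality is used: for \<open>F\<close> without one edge, and
    for the two parts of a disconnected \<open>F\<close>.\<close>
  have no: "card G < card (V G)" if "G \<subset> F" "G \<noteq> {}" for G
    using min[of G] that FE psubset_card_mono[OF finF that(1)] unfolding P_def
    by (meson linorder_not_le psubset_imp_subset subset_trans)
  have nonsing: "F - {e} \<noteq> {}" if "e \<in> F" for e
  proof
    assume "F - {e} = {}"
    then have "F = {e}" using that by auto
    then show False using cF two unfolding V_def by simp
  qed
  have eq: "card (V F) = card F"
  proof (rule ccontr)
    assume "\<not> ?thesis"
    then have lt: "card (V F) < card F" using cF by simp
    obtain e where e: "e \<in> F" using FE by auto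
    have "card (F - {e}) < card (V (F - {e}))" using no[of "F - {e}"] nonsing[OF e] e by blast
    moreover have "card (V (F - {e})) \<le> card (V F)" by (rule card_mono) (auto simp: V_def)
    ultimately show False using lt e finF by simp
  qed
  have deg2: "card {e\<in>F. v \<in> ends e} \<ge> 2" if "v \<in> V F" for v
  proof (rule ccontr)
    assume "\<not> ?thesis"
    moreover have "{e\<in>F. v \<in> ends e} \<noteq> {}" using that unfolding V_def by auto
    then have "card {e\<in>F. v \<in> ends e} \<noteq> 0" using finF by simp
    ultimately have "card {e\<in>F. v \<in> ends e} = 1" by linarith
    then obtain e where e: "{e\<in>F. v \<in> ends e} = {e}" by (auto simp: card_1_singleton_iff)
    then have eF: "e \<in> F" "v \<in> ends e" by auto
    have "V (F - {e}) \<subseteq> V F - {v}" using e unfolding V_def by blast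
    then have "card (V (F - {e})) \<le> card (V F - {v})" by (rule card_mono[rotated]) simp
    then have "card (V (F - {e})) \<le> card F - 1" using that eq by simp
    moreover have "card (F - {e}) < card (V (F - {e}))" using no[of "F - {e}"] nonsing eF by blast
    ultimately show False using eF finF by simp
  qed
  have "(\<Sum>v\<in>V F. card {e\<in>F. v \<in> ends e}) = 2 * card {e\<in>F. ends e \<subseteq> V F}"
    by (rule handshake) (use finF two in \<open>auto simp: V_def\<close>)
  moreover have "{e\<in>F. ends e \<subseteq> V F} = F" unfolding V_def by auto
  ultimately have sum: "(\<Sum>v\<in>V F. card {e\<in>F. v \<in> ends e}) = (\<Sum>v\<in>V F. 2)" using eq by simp
  have deg: "card {e\<in>F. v \<in> ends e} = 2" if v: "v \<in> V F" for v
  proof (rule ccontr)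
    assume "\<not> ?thesis"
    then have "2 < card {e\<in>F. v \<in> ends e}" using deg2[OF v] by simp
    then have "(\<Sum>v\<in>V F. 2) < (\<Sum>v\<in>V F. card {e\<in>F. v \<in> ends e})"
      by (intro sum_strict_mono_ex1) (use deg2 v in auto)
    then show False using sum by simp
  qed
  have conn: "(u, v) \<in> (mg_adj F ends)\<^sup>*" if u: "u \<in> V F" and v: "v \<in> V F" for u v
  proof (rule ccontr)
    assume nr: "\<not> ?thesis"
    define U where "U = {z. (u, z) \<in> (mg_adj F ends)\<^sup>*}"
    define A where "A = {e\<in>F. ends e \<subseteq> U}"
    define B where "B = {e\<in>F. ends e \<inter> U = {}}"
    have cl: "ends e \<subseteq> U \<or> ends e \<inter> U = {}" if "e \<in> F" for e
      using mg_reach_closed[where E=F, of e ends u] two that unfolding U_def by auto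
    have AB: "A \<union> B = F" using cl unfolding A_def B_def by auto
    have AB0: "A \<inter> B = {}"
    proof (rule ccontr)
      assume "A \<inter> B \<noteq> {}"
      then obtain f where "f \<in> F" "ends f = {}" unfolding A_def B_def by blast
      then show False using two by force
    qed
    have VAB: "V A \<inter> V B = {}" "V A \<union> V B = V F" using AB unfolding A_def B_def V_def by auto
    obtain e where e: "e \<in> F" "u \<in> ends e" using u unfolding V_def by auto
    have "u \<in> U" unfolding U_def by simp
    then have "e \<in> A" using cl[of e] e unfolding A_def by auto
    obtain e' where e': "e' \<in> F" "v \<in> ends e'" using v unfolding V_def by auto
    have "v \<notin> U" using nr unfolding U_def by simp
    then have "e' \<in> B" using cl[of e'] e' unfolding B_def by auto
    have "card A < card (V A)" using AB AB0 \<open>e \<in> A\<close> \<open>e' \<in> B\<close> by (intro no) auto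
    moreover have "card B < card (V B)" using AB AB0 \<open>e \<in> A\<close> \<open>e' \<in> B\<close> by (intro no) auto
    moreover have "card A + card B = card F" using AB AB0 finF by (metis card_Un_disjoint finite_Un)
    moreover have "card (V A) + card (V B) = card (V F)" using VAB by (metis card_Un_disjoint finite)
    ultimately show False using eq by simp
  qed
  have "is_cycle E ends F" unfolding is_cycle_def
  proof (intro conjI allI ballI)
    fix v show "card {e\<in>F. v \<in> ends e} = 0 \<or> card {e\<in>F. v \<in> ends e} = 2"
    proof (cases "v \<in> V F")
      case True then show ?thesis using deg by blast
    next
      case False
      then have "{e\<in>F. v \<in> ends e} = {}" unfolding V_def by auto
      then show ?thesis by (simp only: card.empty simp_thms)
    qed
  qed (use FE conn in \<open>auto simp: V_def\<close>)
  then show ?thesis by blast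
qed

section \<open>The cuts of a graph as a group under symmetric difference\<close>

definition cut :: "'e set \<Rightarrow> ('e \<Rightarrow> 'v set) \<Rightarrow> 'v set \<Rightarrow> 'e set" where
  "cut E ends A = {e\<in>E. card (A \<inter> ends e) = 1}"

lemma mem_cut_iff:
  assumes "e \<in> E" "ends e = {x, y}" "x \<noteq> y"
  shows "e \<in> cut E ends A \<longleftrightarrow> (x \<in> A \<longleftrightarrow> y \<notin> A)"
proof -
  have "card (A \<inter> {x, y}) = 1 \<longleftrightarrow> (x \<in> A \<longleftrightarrow> y \<notin> A)"
    using assms(3) by (cases "x \<in> A"; cases "y \<in> A") simp_all
  then show ?thesis using assms(1,2) unfolding cut_def by simp
qed

text \<open>\<open>cut\<close> is the coboundary map over the field with two elements, where
  addition is symmetric difference; this is its linearity.\<close>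

lemma cut_sym_diff:
  assumes "loopless_mg E ends"
  shows "cut E ends (sym_diff A B) = sym_diff (cut E ends A) (cut E ends B)"
proof (rule set_eqI)
  fix e show "e \<in> cut E ends (sym_diff A B) \<longleftrightarrow> e \<in> sym_diff (cut E ends A) (cut E ends B)"
  proof (cases "e \<in> E")
    case True
    then obtain x y where xy: "ends e = {x, y}" "x \<noteq> y"
      using assms unfolding loopless_mg_def by (meson card_2_iff)
    show ?thesis unfolding Un_iff Diff_iff Compl_iff mem_cut_iff[of e E ends, OF True xy] by blast
  next
    case False then show ?thesis by (simp add: cut_def)
  qed
qed

lemma cut_Compl:
  assumes "loopless_mg E ends"
  shows "cut E ends (- A) = cut E ends A"
proof (rule set_eqI)
  fix e show "e \<in> cut E ends (- A) \<longleftrightarrow> e \<in> cut E ends A"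
  proof (cases "e \<in> E")
    case True
    then obtain x y where xy: "ends e = {x, y}" "x \<noteq> y"
      using assms unfolding loopless_mg_def by (meson card_2_iff)
    show ?thesis unfolding Un_iff Diff_iff Compl_iff mem_cut_iff[of e E ends, OF True xy] by blast
  next
    case False then show ?thesis by (simp add: cut_def)
  qed
qed

text \<open>A set with empty cut is a union of components. With \<open>cut_Compl\<close>, the kernel
  of \<open>cut\<close> for a connected graph consists of the empty set and the whole vertex
  set.\<close>

lemma cut_empty_imp:
  assumes E: "loopless_mg E ends" and con: "connected_mg E ends" and cut: "cut E ends A = {}"
    and v: "v \<notin> A"
  shows "A = {}"
proof -
  have "w \<notin> A" if "(v, w) \<in> (mg_adj E ends)\<^sup>*" for w
    using that
  proof induction
    case base show ?case by (rule v)
  next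
    case (step y z)
    then obtain e where e: "e \<in> E" "ends e = {y, z}" unfolding mg_adj_def by auto
    then have "y \<noteq> z" using E unfolding loopless_mg_def by fastforce
    then show ?case using mem_cut_iff[of e E ends, OF e] cut step.IH by auto
  qed
  then show ?thesis using con unfolding connected_mg_def by blast
qed

lemma card_range_cut:
  fixes ends :: "'e \<Rightarrow> 'v::finite set"
  assumes E: "loopless_mg E ends" and con: "connected_mg E ends"
  shows "card (range (cut E ends)) = 2 ^ (CARD('v) - 1)"
proof -
  \<comment> \<open>A base vertex: of \<open>A\<close> and its complement, which have the same cut,
    exactly one avoids \<open>v\<close>.\<close>
  fix v :: 'v
  have "range (cut E ends) = cut E ends ` Pow (UNIV - {v})"
  proof -
    have "cut E ends A \<in> cut E ends ` Pow (UNIV - {v})" for A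
    proof (cases "v \<in> A")
      case True
      then have "- A \<in> Pow (UNIV - {v})" by auto
      then show ?thesis using cut_Compl[OF E, of A] by (metis image_eqI)
    qed auto
    then show ?thesis by auto
  qed
  moreover have "inj_on (cut E ends) (Pow (UNIV - {v}))"
  proof (rule inj_onI)
    fix A B assume AB: "A \<in> Pow (UNIV - {v})" "B \<in> Pow (UNIV - {v})" "cut E ends A = cut E ends B"
    then have "cut E ends (sym_diff A B) = {}" using cut_sym_diff[OF E, of A B] by simp
    moreover have "v \<notin> sym_diff A B" using AB by auto
    ultimately have "sym_diff A B = {}" using cut_empty_imp[OF E con] by blast
    then show "A = B" by auto
  qed
  ultimately have "card (range (cut E ends)) = card (Pow (UNIV - {v}))" by (simp add: card_image)
  then show ?thesis by (simp add: card_Pow card_Diff_singleton)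
qed

text \<open>Cuts are sets of edges, so their number \<open>2 ^ (CARD('v) - 1)\<close> is at most
  \<open>2 ^ card E\<close>; no spanning tree has to be constructed.\<close>

lemma connected_card_ge:
  fixes ends :: "'e \<Rightarrow> 'v::finite set"
  assumes E: "loopless_mg E ends" and con: "connected_mg E ends"
  shows "CARD('v) \<le> card E + 1"
proof -
  have fin: "finite E" using E unfolding loopless_mg_def by auto
  have "card (range (cut E ends)) \<le> card (Pow E)"
    
  proof (rule card_mono)
    show "range (cut E ends) \<subseteq> Pow E" by (auto simp: cut_def)
  qed (simp add: fin)
  then have "(2::nat) ^ (CARD('v) - 1) \<le> 2 ^ card E" using card_range_cut[OF assms] fin by (simp add: card_Pow)
  then show ?thesis by simp
qed

text \<open>Pigeonhole: only half of the edge sets are cuts. A non-cut is the sign pattern from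
  which a family will be built.\<close>

lemma ex_not_cut:
  fixes ends :: "'e \<Rightarrow> 'v::finite set"
  assumes E: "loopless_mg E ends" and con: "connected_mg E ends" and card: "card E = CARD('v)"
  shows "\<exists>S \<subseteq> E. S \<notin> range (cut E ends)"
proof (rule ccontr)
  assume "\<not> ?thesis"
  then have "Pow E \<subseteq> range (cut E ends)" by auto
  then have "card (Pow E) \<le> card (range (cut E ends))" by (rule card_mono[rotated]) simp
  moreover have "finite E" using E unfolding loopless_mg_def by auto
  ultimately have "(2::nat) ^ CARD('v) \<le> 2 ^ (CARD('v) - 1)"
    unfolding card_range_cut[OF E con] by (simp only: card_Pow card)
  moreover have "(2::nat) ^ (CARD('v) - 1) < 2 ^ CARD('v)"
    by (rule power_strict_increasing) simp_all
  ultimately show False by linarith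
qed

text \<open>By counting, the cuts and a single further coset exhaust all edge sets, so two non-cuts
  lie in the same coset.\<close>

lemma sym_diff_not_cuts:
  fixes ends :: "'e \<Rightarrow> 'v::finite set"
  assumes E: "loopless_mg E ends" and con: "connected_mg E ends" and card: "card E = CARD('v)"
    and S: "S \<subseteq> E" "S \<notin> range (cut E ends)" and S': "S' \<subseteq> E" "S' \<notin> range (cut E ends)"
  shows "sym_diff S S' \<in> range (cut E ends)"
proof -
  let ?H = "range (cut E ends)"
  have fin: "finite E" using E unfolding loopless_mg_def by auto
  have "inj (sym_diff S)" by (rule injI) blast
  then have inj: "inj_on (sym_diff S) ?H" by (rule inj_on_subset) simp
  have disj: "?H \<inter> sym_diff S ` ?H = {}"
  proof (rule ccontr)
    assume "\<not> ?thesis"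
    then obtain A B where "cut E ends A = sym_diff S (cut E ends B)" by blast
    then have "S = sym_diff (cut E ends A) (cut E ends B)" by blast
    then have "S = cut E ends (sym_diff A B)" using cut_sym_diff[OF E] by simp
    then show False using S by blast
  qed
  have "?H \<union> sym_diff S ` ?H = Pow E"
  proof (rule card_subset_eq)
    show "finite (Pow E)" using fin by simp
    show "?H \<union> sym_diff S ` ?H \<subseteq> Pow E"
      using S(1) by (auto simp: cut_def)
    have "card (?H \<union> sym_diff S ` ?H) = card ?H + card (sym_diff S ` ?H)"
      by (rule card_Un_disjoint) (use disj in auto)
    also have "\<dots> = 2 * 2 ^ (CARD('v) - 1)"
      using card_image[OF inj] card_range_cut[OF E con] by simp
    also have "\<dots> = 2 ^ CARD('v)" by (rule power_minus_mult[of "CARD('v)" "2::nat", simplified mult.commute]) simp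
    finally show "card (?H \<union> sym_diff S ` ?H) = card (Pow E)" using fin card by (simp add: card_Pow)
  qed
  then have "S' \<in> sym_diff S ` ?H" using S' by blast
  then obtain A where "S' = sym_diff S (cut E ends A)" by blast
  then have "sym_diff S S' = cut E ends A" by blast
  then show ?thesis by blast
qed

text \<open>If the cycle is unique, deleting one of its edges leaves a connected graph without
  cycles, whose edge number is pinned by \<open>connected_card_ge\<close> and
  \<open>ex_cycle\<close>. Conversely, breaking two different cycles one after the other would leave
  a connected graph with two edges fewer than vertices.\<close>

lemma in_M_iff:
  fixes ends :: "'e \<Rightarrow> 'v::finite set"
  shows "in_M E ends \<longleftrightarrow> loopless_mg E ends \<and> connected_mg E ends \<and> card E = CARD('v)"
proof (cases "loopless_mg E ends \<and> connected_mg E ends")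
  case True
  then have E: "loopless_mg E ends" and con: "connected_mg E ends" by auto
  have finE: "finite E" using E unfolding loopless_mg_def by auto
  have sub: "loopless_mg (E - {e}) ends" for e using E unfolding loopless_mg_def by auto
  have "(\<exists>!C. is_cycle E ends C) \<longleftrightarrow> card E = CARD('v)"
  proof
    assume "\<exists>!C. is_cycle E ends C"
    then obtain C where C: "is_cycle E ends C" and uniq: "\<And>C'. is_cycle E ends C' \<Longrightarrow> C' = C" by auto
    obtain e where e: "e \<in> C" "e \<in> E" using is_cycle_subset[OF C] is_cycle_nonempty[OF C] by blast
    have cardE: "card E = card (E - {e}) + 1" using e finE by (metis Suc_eq_plus1 card_Suc_Diff1)
    have "CARD('v) \<le> card (E - {e}) + 1"
      by (rule connected_card_ge[OF sub connected_remove_cycle_edge[OF E con C e(1)]])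
    moreover have "\<not> CARD('v) \<le> card (E - {e})"
    proof
      assume "CARD('v) \<le> card (E - {e})"
      then obtain C' where "is_cycle (E - {e}) ends C'" using ex_cycle[OF sub] by blast
      then have "is_cycle E ends C'" "e \<notin> C'" using is_cycle_subset_iff[of "E - {e}" E ends C'] by blast+
      then show False using uniq e by blast
    qed
    ultimately show "card E = CARD('v)" using cardE by linarith
  next
    assume card: "card E = CARD('v)"
    then obtain C where C: "is_cycle E ends C" using ex_cycle[OF E] by auto
    moreover have "C' = C" if C': "is_cycle E ends C'" for C'
    proof (rule ccontr)
      assume "C' \<noteq> C"
      then obtain e where e: "e \<in> C" "e \<notin> C'" using cycle_subset_eq[OF E C C'] by blast
      have eE: "e \<in> E" using is_cycle_subset[OF C] e by blast
      have con1: "connected_mg (E - {e}) ends" by (rule connected_remove_cycle_edge[OF E con C e(1)])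
      have C1: "is_cycle (E - {e}) ends C'"
        using is_cycle_subset_iff[of "E - {e}" E ends C'] C' e is_cycle_subset[OF C'] by blast
      obtain e' where e': "e' \<in> C'" "e' \<in> E - {e}"
        using is_cycle_subset[OF C1] is_cycle_nonempty[OF C1] by blast
      have "connected_mg (E - {e} - {e'}) ends" by (rule connected_remove_cycle_edge[OF sub con1 C1 e'(1)])
      moreover have "loopless_mg (E - {e} - {e'}) ends" using sub unfolding loopless_mg_def by auto
      ultimately have "CARD('v) \<le> card (E - {e} - {e'}) + 1" by (rule connected_card_ge[rotated])
      moreover have "card (E - {e} - {e'}) + 2 = card E"
        using e' eE finE by (metis Suc_1 add_2_eq_Suc' card_Suc_Diff1 finite_Diff)
      ultimately show False using card by simp
    qed
    ultimately show "\<exists>!C. is_cycle E ends C" by blast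
  qed
  then show ?thesis using True unfolding in_M_def by auto
qed (auto simp: in_M_def)

section \<open>Reflection groups and the Weyl group of type D\<close>

lemma reflect_scaleR: "c \<noteq> 0 \<Longrightarrow> reflect (c *\<^sub>R s) = reflect s"
  unfolding reflect_def by (cases "s = 0") (auto simp: field_simps)

lemma reflect_uminus: "reflect (- s) = reflect s"
  using reflect_scaleR[of "-1" s] by simp

lemma reflect_orthogonal_image:
  assumes "orthogonal_transformation T"
  shows "reflect (T s) (T x) = T (reflect s x)"
  using assms unfolding orthogonal_transformation_def reflect_def
  by (simp add: linear_diff linear_cmul)

lemma reflect_involution [simp]: "reflect s (reflect s x) = x"
proof (cases "s = 0")
  case False
  then show ?thesis unfolding reflect_def by (simp add: inner_diff_left field_simps)
qed (simp add: reflect_def)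

lemma orthogonal_transformation_reflect: "orthogonal_transformation (reflect s)"
proof (cases "s = 0")
  case True
  then have "reflect s = id" by (auto simp: reflect_def)
  then show ?thesis by (simp add: orthogonal_transformation_def linear_id)
next
  case False
  have "linear (reflect s)"
    by (rule linearI) (auto simp: reflect_def inner_add_left algebra_simps add_divide_distrib)
  moreover have "reflect s v \<bullet> reflect s w = v \<bullet> w" for v w
    using False by (simp add: reflect_def inner_diff_left inner_diff_right inner_commute field_simps)
  ultimately show ?thesis unfolding orthogonal_transformation_def by blast
qed

text \<open>Conjugation inside a reflection group is the means of obtaining reflections in new roots
  from those in given ones.\<close>

lemma reflect_reflect: "reflect (reflect s r) = reflect s \<circ> reflect r \<circ> reflect s"
proof
  fix x
  show "reflect (reflect s r) x = (reflect s \<circ> reflect r \<circ> reflect s) x"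
    using reflect_orthogonal_image[OF orthogonal_transformation_reflect, of s r "reflect s x"] by simp
qed

lemma refl_group_comp: "w \<in> refl_group S \<Longrightarrow> w' \<in> refl_group S \<Longrightarrow> w \<circ> w' \<in> refl_group S"
  by (induction rule: refl_group.induct) (auto simp: comp_assoc intro: refl_group.intros)

lemma reflect_in_refl_group: "s \<in> S \<Longrightarrow> reflect s \<in> refl_group S"
  using refl_group_step[OF refl_group_id, of s S] by simp

lemma refl_group_least:
  assumes "\<And>s. s \<in> S \<Longrightarrow> reflect s \<in> refl_group S'"
  shows "refl_group S \<subseteq> refl_group S'"
proof
  fix w assume "w \<in> refl_group S"
  then show "w \<in> refl_group S'"
    by induction (blast intro: refl_group_id refl_group_comp assms)+
qed

lemma reflect_comp_orthogonal:
  "orthogonal_transformation T \<Longrightarrow> reflect (T s) \<circ> T = T \<circ> reflect s"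
  by (auto simp: reflect_orthogonal_image)

text \<open>Moving the normals by an isometry conjugates the group, which is exactly the shape of
  the condition in \<open>generates_D\<close>.\<close>

lemma refl_group_image:
  fixes T :: "real^'n \<Rightarrow> real^'n"
  assumes T: "orthogonal_transformation T"
  shows "refl_group (T ` S) = (\<lambda>w. T \<circ> w \<circ> inv T) ` refl_group S"
proof (intro equalityI subsetI)
  have TT: "T \<circ> inv T = id" using orthogonal_transformation_surj[OF T] by (simp flip: surj_iff)
  have step: "reflect (T s) \<circ> (T \<circ> w \<circ> inv T) = T \<circ> (reflect s \<circ> w) \<circ> inv T" for s w
    by (simp only: comp_assoc[symmetric] reflect_comp_orthogonal[OF T])
  fix w
  show "w \<in> (\<lambda>w. T \<circ> w \<circ> inv T) ` refl_group S" if "w \<in> refl_group (T ` S)"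
    using that
  proof induction
    case refl_group_id
    show ?case
    proof (rule image_eqI)
      show "id = T \<circ> id \<circ> inv T" using TT by simp
    qed (rule refl_group.refl_group_id)
  next
    case (refl_group_step w s)
    then obtain w' s' where *: "w = T \<circ> w' \<circ> inv T" "w' \<in> refl_group S" "s = T s'" "s' \<in> S"
      by (elim imageE) (rule that)
    have "reflect s' \<circ> w' \<in> refl_group S" using *(2,4) by (rule refl_group.refl_group_step)
    then show ?case unfolding *(1,3) step by (rule imageI)
  qed
  have "T \<circ> w \<circ> inv T \<in> refl_group (T ` S)" if "w \<in> refl_group S" for w
    using that
  proof induction
    case refl_group_id
    show ?case unfolding comp_id TT by (rule refl_group.refl_group_id)
  next
    case (refl_group_step w s)
    have "reflect (T s) \<circ> (T \<circ> w \<circ> inv T) \<in> refl_group (T ` S)"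
      using refl_group_step.IH imageI[OF refl_group_step.hyps(2)] by (rule refl_group.refl_group_step)
    then show ?case unfolding step .
  qed
  then show "w \<in> refl_group (T ` S)" if "w \<in> (\<lambda>w. T \<circ> w \<circ> inv T) ` refl_group S"
    using that by blast
qed

text \<open>Conjugation is injective. Comparing orders later turns an inclusion in the finite group
  \<open>W_D\<close> into an equality.\<close>

lemma card_refl_group_image:
  fixes T :: "real^'n \<Rightarrow> real^'n"
  assumes T: "orthogonal_transformation T"
  shows "card (refl_group (T ` S)) = card (refl_group S)"
proof -
  have "inj_on (\<lambda>w. T \<circ> w \<circ> inv T) (refl_group S)"
  proof (rule inj_onI)
    fix w w' assume eq: "T \<circ> w \<circ> inv T = T \<circ> w' \<circ> inv T"
    have bij: "bij T" by (rule orthogonal_transformation_bij[OF T])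
    show "w = w'"
    proof
      fix x
      have "T (w x) = T (w' x)"
        using fun_cong[OF eq, of "T x"] bij by (simp add: bij_is_inj)
      then show "w x = w' x" using bij by (simp add: bij_is_inj inj_eq)
    qed
  qed
  then show ?thesis unfolding refl_group_image[OF T] by (rule card_image)
qed

lemma refl_group_pm_set: "refl_group (pm_set f) = refl_group (range f)"
proof (rule equalityI; rule refl_group_least)
  fix s assume "s \<in> pm_set f"
  then have "s \<in> range f \<or> - s \<in> range f" unfolding pm_set_def by auto
  then show "reflect s \<in> refl_group (range f)"
    using reflect_in_refl_group[of s "range f"] reflect_in_refl_group[of "- s" "range f"]
    by (auto simp: reflect_uminus)
qed (auto simp: pm_set_def intro: reflect_in_refl_group)

lemma pm_set_orthogonal_comp:
  fixes T :: "real^'n \<Rightarrow> real^'n"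
  assumes "orthogonal_transformation T"
  shows "pm_set (T \<circ> f) = T ` pm_set f"
proof -
  have "T (- x) = - T x" for x using assms by (simp add: orthogonal_transformation_def linear_neg)
  then show ?thesis unfolding pm_set_def image_Un by (auto simp: image_iff)
qed

lemma is_family_orthogonal_comp:
  fixes T :: "real^'n \<Rightarrow> real^'n"
  assumes T: "orthogonal_transformation T" and f: "is_family f"
  shows "is_family (T \<circ> f)"
proof -
  have inj: "inj T" by (rule orthogonal_transformation_inj[OF T])
  have "independent (T ` range f)"
    using T f inj unfolding is_family_def orthogonal_transformation_def
    by (intro linear_independent_injective_image) (auto intro: inj_on_subset)
  then show ?thesis using f inj orthogonal_transformation_norm[OF T]
    unfolding is_family_def by (auto simp: inj_compose image_image)
qed

section \<open>The roots and the Weyl group of type D\<close>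

lemma Delta_D_iff:
  "r \<in> Delta_D \<longleftrightarrow> (\<exists>i j. i \<noteq> j \<and> \<bar>r $ i\<bar> = 1 \<and> \<bar>r $ j\<bar> = 1 \<and> (\<forall>k. k \<noteq> i \<longrightarrow> k \<noteq> j \<longrightarrow> r $ k = 0))"
proof
  assume "r \<in> Delta_D"
  then obtain i j a b where "r = a *\<^sub>R axis i 1 + b *\<^sub>R axis j 1" "i \<noteq> j" "a = 1 \<or> a = -1" "b = 1 \<or> b = -1"
    unfolding Delta_D_def by auto
  then have "i \<noteq> j \<and> \<bar>r $ i\<bar> = 1 \<and> \<bar>r $ j\<bar> = 1 \<and> (\<forall>k. k \<noteq> i \<longrightarrow> k \<noteq> j \<longrightarrow> r $ k = 0)"
    by (auto simp: axis_def)
  then show "\<exists>i j. i \<noteq> j \<and> \<bar>r $ i\<bar> = 1 \<and> \<bar>r $ j\<bar> = 1 \<and> (\<forall>k. k \<noteq> i \<longrightarrow> k \<noteq> j \<longrightarrow> r $ k = 0)" by blast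
next
  assume "\<exists>i j. i \<noteq> j \<and> \<bar>r $ i\<bar> = 1 \<and> \<bar>r $ j\<bar> = 1 \<and> (\<forall>k. k \<noteq> i \<longrightarrow> k \<noteq> j \<longrightarrow> r $ k = 0)"
  then obtain i j where ij: "i \<noteq> j" "\<bar>r $ i\<bar> = 1" "\<bar>r $ j\<bar> = 1" "\<forall>k. k \<noteq> i \<longrightarrow> k \<noteq> j \<longrightarrow> r $ k = 0" by blast
  then have "r = (r $ i) *\<^sub>R axis i 1 + (r $ j) *\<^sub>R axis j 1"
    by (auto simp: vec_eq_iff axis_def)
  moreover have "r $ i = 1 \<or> r $ i = -1" "r $ j = 1 \<or> r $ j = -1" using ij by linarith+
  ultimately show "r \<in> Delta_D" using ij(1) unfolding Delta_D_def by blast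
qed

text \<open>A root up to sign, scaled to have leading coefficient 1. For \<open>s = 1\<close> and
  \<open>s = -1\<close> these are the two possible normals of an edge between \<open>i\<close> and
  \<open>j\<close>.\<close>

definition pm_root :: "'n \<Rightarrow> real \<Rightarrow> 'n \<Rightarrow> real^'n" where
  "pm_root i s j = axis i 1 + s *\<^sub>R axis j 1"

lemma inner_pm_root: "x \<bullet> pm_root i s j = x $ i + s * x $ j"
  unfolding pm_root_def by (simp add: inner_add_right inner_axis)

lemma Delta_D_pm_rootE:
  assumes "r \<in> Delta_D"
  obtains i j s c where "i \<noteq> j" "s = 1 \<or> s = -1" "c = 1 \<or> c = -1" "r = c *\<^sub>R pm_root i s j"
proof -
  obtain i j a b where *: "r = a *\<^sub>R axis i 1 + b *\<^sub>R axis j 1" "i \<noteq> j" "a = 1 \<or> a = -1" "b = 1 \<or> b = -1"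
    using assms unfolding Delta_D_def by auto
  show thesis
  proof (rule that[of i j "a * b" a])
    show "a * b = 1 \<or> a * b = -1" using *(3,4) by auto
    have "a * a = 1" using *(3) by auto
    then show "r = a *\<^sub>R pm_root i (a * b) j"
      unfolding *(1) pm_root_def by (simp add: scaleR_add_right mult.assoc[symmetric])
  qed (use *(2,3) in auto)
qed

lemma pm_root_in_Delta_D: "i \<noteq> j \<Longrightarrow> s = 1 \<or> s = -1 \<Longrightarrow> pm_root i s j \<in> Delta_D"
  unfolding Delta_D_iff by (rule exI[of _ i], rule exI[of _ j]) (auto simp: pm_root_def axis_def)

text \<open>The reflection exchanges two coordinates; for \<open>s = 1\<close> it also changes the
  sign of both.\<close>

lemma reflect_pm_root:
  assumes "i \<noteq> j" "s = 1 \<or> s = -1"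
  shows "reflect (pm_root i s j) x $ k = (if k = i then - s * x $ j else if k = j then - s * x $ i else x $ k)"
proof -
  have "pm_root i s j \<bullet> pm_root i s j = 2" using assms by (auto simp: inner_pm_root) (auto simp: pm_root_def axis_def)
  moreover have "pm_root i s j $ k = (if k = i then 1 else if k = j then s else 0)"
    using assms by (auto simp: pm_root_def axis_def)
  ultimately show ?thesis using assms unfolding reflect_def by (auto simp: inner_pm_root algebra_simps)
qed

lemma reflect_Delta_D:
  assumes "r \<in> Delta_D"
  obtains i j s where "i \<noteq> j" "s = 1 \<or> s = -1" "reflect r = reflect (pm_root i s j)"
  using assms
proof (rule Delta_D_pm_rootE)
  fix i j s c assume *: "i \<noteq> j" "s = 1 \<or> s = -1" "c = 1 \<or> c = -1" "r = c *\<^sub>R pm_root i s j"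
  have "reflect r = reflect (pm_root i s j)" unfolding *(4) by (rule reflect_scaleR) (use *(3) in auto)
  with *(1,2) show thesis by (rule that)
qed

text \<open>Every generator exchanges two coordinates and changes both signs or neither. The product
  of the coordinates records that the number of sign changes is even, without naming the
  signs.\<close>

lemma W_D_invariants:
  assumes "w \<in> W_D"
  shows W_D_linear: "linear w"
    and W_D_axis: "\<exists>j. w (axis i 1) = axis j 1 \<or> w (axis i 1) = - axis j 1"
    and W_D_prod: "(\<Prod>k\<in>UNIV. w x $ k) = (\<Prod>k\<in>UNIV. x $ k)"
proof -
  have "linear w \<and> (\<forall>i. \<exists>j. w (axis i 1) = axis j 1 \<or> w (axis i 1) = - axis j 1) \<and>
      (\<forall>x. (\<Prod>k\<in>UNIV. w x $ k) = (\<Prod>k\<in>UNIV. x $ k))"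
    using assms unfolding W_D_def
  proof induction
    case refl_group_id
    show ?case by (auto simp: linear_id[unfolded id_def])
  next
    case (refl_group_step w r)
    obtain i j s where ij: "i \<noteq> j" "s = 1 \<or> s = -1" "reflect r = reflect (pm_root i s j)"
      using refl_group_step.hyps(2) by (rule reflect_Delta_D)
    have lin: "linear (reflect r)"
      using orthogonal_transformation_reflect orthogonal_transformation_def by blast
    have ax: "\<exists>m. reflect r (axis l 1) = axis m 1 \<or> reflect r (axis l 1) = - axis m 1" for l
    proof -
      have "reflect r (axis l 1) = (if l = i then - s *\<^sub>R axis j 1 else if l = j then - s *\<^sub>R axis i 1 else axis l 1)"
        using ij(1,2) unfolding ij(3) by (auto simp: vec_eq_iff reflect_pm_root axis_def)
      then show ?thesis using ij(2) by (cases "l = i"; cases "l = j") auto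
    qed
    have "\<exists>m. (reflect r \<circ> w) (axis l 1) = axis m 1 \<or> (reflect r \<circ> w) (axis l 1) = - axis m 1" for l
    proof -
      obtain m where "w (axis l 1) = axis m 1 \<or> w (axis l 1) = - axis m 1" using refl_group_step.IH by blast
      moreover obtain m' where "reflect r (axis m 1) = axis m' 1 \<or> reflect r (axis m 1) = - axis m' 1"
        using ax by blast
      ultimately show ?thesis using linear_neg[OF lin] by fastforce
    qed
    moreover have "(\<Prod>k\<in>UNIV. reflect r y $ k) = (\<Prod>k\<in>UNIV. y $ k)" for y
    proof -
      have split: "(\<Prod>k\<in>UNIV. z $ k) = z $ i * (z $ j * (\<Prod>k\<in>UNIV - {i} - {j}. z $ k))" for z :: "real^'a"
        using ij(1) by (subst prod.remove[of _ i], simp, simp, subst prod.remove[of _ j]) auto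
      show ?thesis unfolding split unfolding ij(3) using ij(1,2) by (auto simp: reflect_pm_root)
    qed
    ultimately show ?case using refl_group_step.IH linear_compose[OF _ lin, of w] by (simp add: comp_def)
  qed
  then show "linear w" "\<exists>j. w (axis i 1) = axis j 1 \<or> w (axis i 1) = - axis j 1"
    "(\<Prod>k\<in>UNIV. w x $ k) = (\<Prod>k\<in>UNIV. x $ k)" by auto
qed

text \<open>A reflection that is a signed permutation either negates one basis vector, which the
  invariance of the product forbids, or exchanges two of them up to sign, and then its normal is
  proportional to a root.\<close>

lemma reflect_in_W_D_imp:
  assumes s: "norm s = 1" and W: "reflect s \<in> W_D"
  shows "sqrt 2 *\<^sub>R s \<in> Delta_D"
proof -
  have ss: "s \<bullet> s = 1" using s by (simp add: norm_eq_1)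
  then have "s \<noteq> 0" by auto
  then obtain i where i: "s $ i \<noteq> 0" by (auto simp: vec_eq_iff)
  obtain j where j: "reflect s (axis i 1) = axis j 1 \<or> reflect s (axis i 1) = - axis j 1"
    using W_D_axis[OF W] by blast
  have rs: "reflect s (axis i 1) $ k = axis i 1 $ k - 2 * s $ i * s $ k" for k
    unfolding reflect_def ss by (simp add: inner_axis')
  show ?thesis
  proof (cases "j = i")
    case True
    have "axis i 1 $ i - 2 * s $ i * s $ i \<noteq> (1::real)" using i by (simp add: axis_def)
    then have neg: "reflect s (axis i 1) = - axis i 1" using j True rs[of i] by (auto simp: axis_def)
    then have k: "2 * s $ i * s $ k = (if k = i then 2 else 0)" for k
      using rs[of k] by (auto simp: axis_def split: if_splits)
    \<comment> \<open>\<open>1\<close> is the all-ones vector. The reflection would negate only its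
      coordinate \<open>i\<close>, so the product of coordinates would become -1.\<close>
    have "reflect s 1 $ k = (if k = i then -1 else 1)" for k
    proof -
      have "1 \<bullet> s = (\<Sum>l\<in>UNIV. s $ l)" by (simp add: inner_vec_def)
      also have "\<dots> = (\<Sum>l\<in>UNIV. if l = i then s $ i else 0)"
        proof (intro sum.cong refl)
        fix l show "s $ l = (if l = i then s $ i else 0)" using k[of l] i by (cases "l = i") auto
      qed
      finally have "1 \<bullet> s = s $ i" by simp
      then show ?thesis using k[of k] unfolding reflect_def ss by auto
    qed
    then have "(\<Prod>k\<in>UNIV. reflect s 1 $ k) = (\<Prod>k\<in>UNIV. if k = i then -1 else 1)" by simp
    also have "\<dots> = -1" by (simp add: prod.delta)
    finally show ?thesis using W_D_prod[OF W, of 1] by simp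
  next
    case False
    have i2: "2 * s $ i * s $ i = 1" using j False rs[of i] by (auto simp: axis_def)
    have j2: "\<bar>2 * s $ i * s $ j\<bar> = 1" using j False rs[of j] by (auto simp: axis_def)
    have k0: "s $ k = 0" if "k \<noteq> i" "k \<noteq> j" for k
      using j that i rs[of k] by (auto simp: axis_def)
    have "(sqrt 2 * s $ i)\<^sup>2 = 1" using i2 by (simp add: power_mult_distrib) (simp add: power2_eq_square)
    moreover have "(2 * s $ i * s $ j)\<^sup>2 = 1" using j2 by (simp add: abs_square_eq_1)
    then have "2 * (2 * s $ i * s $ i) * (s $ j)\<^sup>2 = 1" by (simp add: power2_eq_square algebra_simps)
    then have "(sqrt 2 * s $ j)\<^sup>2 = 1" using i2 by (simp add: power_mult_distrib)
    ultimately have "\<bar>sqrt 2 * s $ i\<bar> = 1" "\<bar>sqrt 2 * s $ j\<bar> = 1" by (simp_all add: abs_square_eq_1)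
    then show ?thesis unfolding Delta_D_iff using False k0
      by - (rule exI[of _ i], rule exI[of _ j], auto)
  qed
qed

text \<open>An element is determined by the images of the basis vectors, for which there are
  finitely many choices.\<close>

lemma finite_W_D: "finite (W_D :: (real^'n::finite \<Rightarrow> real^'n) set)"
proof -
  define B :: "(real^'n) set" where "B = range (\<lambda>j. axis j 1) \<union> range (\<lambda>j. - axis j 1)"
  define F where "F w = (\<lambda>i. w (axis i 1))" for w :: "real^'n \<Rightarrow> real^'n"
  have "finite (PiE UNIV (\<lambda>_::'n. B))" by (intro finite_PiE) (auto simp: B_def)
  moreover have "F w \<in> PiE UNIV (\<lambda>_. B)" if w: "w \<in> W_D" for w
  proof -
    have "w (axis i 1) \<in> B" for i using W_D_axis[OF w, of i] unfolding B_def by auto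
    then show ?thesis unfolding F_def by auto
  qed
  then have "F ` W_D \<subseteq> PiE UNIV (\<lambda>_. B)" by blast
  moreover have "inj_on F W_D"
  proof (rule inj_onI)
    fix w w' assume w: "w \<in> W_D" "w' \<in> W_D" "F w = F w'"
    show "w = w'"
    proof (rule linear_eq_stdbasis[OF W_D_linear[OF w(1)] W_D_linear[OF w(2)]])
      fix b :: "real^'n" assume "b \<in> Basis"
      then obtain i where "b = axis i 1" by (auto simp: Basis_vec_def)
      then show "w b = w' b" using fun_cong[OF w(3), of i] by (simp add: F_def)
    qed
  qed
  ultimately show ?thesis by (meson finite_imageD finite_subset)
qed

section \<open>Families with normals in the root system\<close>

lemma is_family_orthogonal_imp_zero:
  fixes f :: "'n \<Rightarrow> real^'n"
  assumes f: "is_family f" and x: "\<And>k. x \<bullet> f k = 0"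
  shows "x = 0"
proof -
  have "card (range f) = DIM(real^'n)" using f unfolding is_family_def by (simp add: card_image)
  then have "UNIV \<subseteq> span (range f)"
    using f unfolding is_family_def by (intro card_ge_dim_independent) auto
  then have "orthogonal x x"
    by (intro orthogonal_to_span[of x "range f"]) (use x in \<open>auto simp: orthogonal_def\<close>)
  then show ?thesis by (simp add: orthogonal_def)
qed

text \<open>Together with \<open>is_family_orthogonal_imp_zero\<close> this turns independence into
  triviality of the orthogonal complement, the form suited to sign patterns. A spanning set of at
  most \<open>CARD('n)\<close> vectors is a basis, and its size then makes \<open>f\<close>
  injective.\<close>

lemma is_family_if_orthogonal_zero:
  fixes f :: "'n \<Rightarrow> real^'n"
  assumes norm: "\<And>k. norm (f k) = 1" and zero: "\<And>x. (\<And>k. x \<bullet> f k = 0) \<Longrightarrow> x = 0"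
  shows "is_family f"
proof -
  have span: "span (range f) = UNIV"
  proof (rule ccontr)
    assume "\<not> ?thesis"
    then obtain a where "a \<noteq> 0" "\<forall>x\<in>span (range f). a \<bullet> x = 0"
      using span_not_UNIV_orthogonal by blast
    then show False using zero[of a] by (simp add: span_base)
  qed
  have "card (range f) \<le> dim (UNIV :: (real^'n) set)"
    using card_image_le[of UNIV f] by simp
  then have ind: "independent (range f)"
    using span by (intro card_le_dim_spanning[of _ UNIV]) auto
  then have "card (range f) = dim (span (range f))" by (simp add: dim_eq_card_independent)
  then have "card (range f) = CARD('n)" by (simp add: span)
  then have "inj f" by (intro eq_card_imp_inj_on) auto
  then show ?thesis using norm ind unfolding is_family_def by auto
qed

lemma pm_root_swap: "s = 1 \<or> s = -1 \<Longrightarrow> pm_root j s i = s *\<^sub>R pm_root i s j"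
  unfolding pm_root_def by auto

text \<open>The order of the two ends may be prescribed, because exchanging them only multiplies
  \<open>pm_root\<close> by its sign.\<close>

lemma Delta_family_edge:
  assumes g: "Delta_family g" and e: "fam_ends g k = {y, z}" "y \<noteq> z"
  obtains t c where "t = 1 \<or> t = -1" "c \<noteq> 0" "g k = c *\<^sub>R pm_root y t z"
proof -
  have "sqrt 2 *\<^sub>R g k \<in> Delta_D" using g unfolding Delta_family_def by blast
  then show thesis
  proof (rule Delta_D_pm_rootE)
    fix i j s c assume *: "i \<noteq> j" "s = 1 \<or> s = -1" "c = 1 \<or> c = -1" "sqrt 2 *\<^sub>R g k = c *\<^sub>R pm_root i s j"
    have "(1 / sqrt 2) *\<^sub>R (sqrt 2 *\<^sub>R g k) = (c / sqrt 2) *\<^sub>R pm_root i s j" unfolding *(4) by simp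
    then have gk: "g k = (c / sqrt 2) *\<^sub>R pm_root i s j" by simp
    have "fam_ends g k = {i, j}"
      unfolding fam_ends_def gk pm_root_def using *(1-3) by (auto simp: axis_def)
    then consider "y = i" "z = j" | "y = j" "z = i" using e by (auto simp: doubleton_eq_iff)
    then show thesis
    proof cases
      case 1
      then show thesis using that[of s "c / sqrt 2"] gk *(2,3) by auto
    next
      case 2
      have "s * s = 1" using *(2) by auto
      then have "g k = (c / sqrt 2 * s) *\<^sub>R pm_root y s z"
        unfolding gk 2 pm_root_swap[OF *(2), of j i] by (simp add: mult.assoc)
      then show thesis using that[of s "c / sqrt 2 * s"] *(2,3) by auto
    qed
  qed
qed

lemma Delta_family_card_ends:
  assumes "Delta_family g"
  shows "card (fam_ends g k) = 2"
proof -
  have "sqrt 2 *\<^sub>R g k \<in> Delta_D" using assms unfolding Delta_family_def by blast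
  then obtain i j where ij: "i \<noteq> j" "\<bar>(sqrt 2 *\<^sub>R g k) $ i\<bar> = 1" "\<bar>(sqrt 2 *\<^sub>R g k) $ j\<bar> = 1"
      "\<forall>l. l \<noteq> i \<longrightarrow> l \<noteq> j \<longrightarrow> (sqrt 2 *\<^sub>R g k) $ l = 0"
    unfolding Delta_D_iff by blast
  then have "fam_ends g k = {i, j}" unfolding fam_ends_def by auto
  then show ?thesis using ij(1) by simp
qed

lemma Delta_family_loopless: "Delta_family (g :: 'n::finite \<Rightarrow> real^'n) \<Longrightarrow> loopless_mg UNIV (fam_ends g)"
  unfolding loopless_mg_def by (simp add: Delta_family_card_ends)

lemma Delta_family_refl_group_subset:
  fixes g :: "'n::finite \<Rightarrow> real^'n"
  assumes "Delta_family g"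
  shows "refl_group (range g) \<subseteq> W_D"
  unfolding W_D_def
proof (rule refl_group_least)
  fix s assume "s \<in> range g"
  then obtain k where k: "s = g k" by blast
  have "reflect (sqrt 2 *\<^sub>R g k) \<in> refl_group Delta_D"
    using assms unfolding Delta_family_def by (intro reflect_in_refl_group) blast
  then show "reflect s \<in> refl_group Delta_D" unfolding k by (simp add: reflect_scaleR)
qed

text \<open>The reflections of \<open>g\<close> lie in \<open>W_D\<close> because its normals are
  proportional to roots; equality follows since the group is conjugate to \<open>W_D\<close> and
  hence has the same finite order.\<close>

lemma generates_D_Delta_family_refl_group:
  fixes f g :: "'n::finite \<Rightarrow> real^'n"
  assumes f: "generates_D f" and iso: "fam_isometric f g" and g: "Delta_family g"
  shows "refl_group (range g) = W_D"
proof (rule card_subset_eq[OF finite_W_D Delta_family_refl_group_subset[OF g]])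
  obtain T where T: "orthogonal_transformation T" "T ` pm_set f = pm_set g"
    using iso unfolding fam_isometric_def by blast
  obtain U :: "real^'n \<Rightarrow> real^'n" where U: "orthogonal_transformation U"
      "W_D = (\<lambda>w. U \<circ> w \<circ> inv U) ` refl_group (range f)"
    using f unfolding generates_D_def by blast
  have "card (refl_group (range g)) = card (refl_group (T ` pm_set f))"
    unfolding T(2) refl_group_pm_set ..
  also have "\<dots> = card (refl_group (range f))"
    unfolding card_refl_group_image[OF T(1)] refl_group_pm_set ..
  also have "\<dots> = card (refl_group (U ` range f))" unfolding card_refl_group_image[OF U(1)] ..
  also have "\<dots> = card (W_D :: (real^'n \<Rightarrow> real^'n) set)" unfolding U(2) refl_group_image[OF U(1)] ..
  finally show "card (refl_group (range g)) = card (W_D :: (real^'n \<Rightarrow> real^'n) set)" .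
qed

text \<open>The isometry that conjugates the group to \<open>W_D\<close> moves every normal to one
  whose reflection lies in \<open>W_D\<close>, hence to a multiple of a root.\<close>

lemma generates_D_ex_Delta_family:
  fixes f :: "'n::finite \<Rightarrow> real^'n"
  assumes f: "generates_D f"
  obtains g where "fam_isometric f g" "is_family g" "Delta_family g"
proof -
  obtain U :: "real^'n \<Rightarrow> real^'n" where U: "orthogonal_transformation U"
      "W_D = (\<lambda>w. U \<circ> w \<circ> inv U) ` refl_group (range f)"
    using f unfolding generates_D_def by blast
  have "range (U \<circ> f) = U ` range f" by (simp add: image_comp)
  then have W: "W_D = refl_group (range (U \<circ> f))"
    unfolding U(2) by (simp only: refl_group_image[OF U(1)])
  have fam: "is_family (U \<circ> f)"
    using f by (intro is_family_orthogonal_comp[OF U(1)]) (simp add: generates_D_def)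
  have "Delta_family (U \<circ> f)" unfolding Delta_family_def
  proof
    fix k
    show "sqrt 2 *\<^sub>R (U \<circ> f) k \<in> Delta_D"
    proof (rule reflect_in_W_D_imp)
      show "norm ((U \<circ> f) k) = 1" using fam unfolding is_family_def by blast
      show "reflect ((U \<circ> f) k) \<in> W_D" unfolding W by (intro reflect_in_refl_group) blast
    qed
  qed
  moreover have "fam_isometric f (U \<circ> f)"
    unfolding fam_isometric_def using U(1) pm_set_orthogonal_comp[OF U(1), of f] by metis
  ultimately show thesis using fam that by blast
qed

text \<open>The group keeps the orbit of a basis vector supported on the component of its vertex,
  whereas \<open>W_D\<close> can exchange any two basis vectors.\<close>

lemma refl_group_W_D_imp_connected:
  fixes g :: "'n::finite \<Rightarrow> real^'n"
  assumes g: "Delta_family g" and W: "refl_group (range g) = W_D"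
  shows "connected_mg UNIV (fam_ends g)"
proof -
  have "(i, j) \<in> (mg_adj UNIV (fam_ends g))\<^sup>*" for i j
  proof (rule ccontr)
    assume nr: "\<not> ?thesis"
    define U where "U = {z. (i, z) \<in> (mg_adj UNIV (fam_ends g))\<^sup>*}"
    have j: "j \<notin> U" "j \<noteq> i" using nr unfolding U_def by auto
    have inv: "\<forall>k. k \<notin> U \<longrightarrow> w (axis i 1) $ k = 0" if "w \<in> refl_group (range g)" for w
      using that
    proof induction
      case refl_group_id
      then show ?case unfolding U_def by (auto simp: axis_def)
    next
      case (refl_group_step w s)
      obtain k where k: "s = g k" using refl_group_step.hyps by blast
      have "fam_ends g k \<subseteq> U \<or> fam_ends g k \<inter> U = {}"
        unfolding U_def by (rule mg_reach_closed) (simp_all add: Delta_family_card_ends[OF g])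
      then show ?case
      proof
        assume "fam_ends g k \<subseteq> U"
        then have "\<forall>l. l \<notin> U \<longrightarrow> g k $ l = 0" unfolding fam_ends_def by blast
        then show ?thesis using refl_group_step.IH unfolding k by (simp add: reflect_def)
      next
        assume "fam_ends g k \<inter> U = {}"
        then have "\<forall>l. w (axis i 1) $ l * g k $ l = 0" using refl_group_step.IH unfolding fam_ends_def by auto
        then have "w (axis i 1) \<bullet> g k = 0"
          unfolding inner_vec_def inner_real_def by (intro sum.neutral) blast
        then show ?thesis using refl_group_step.IH unfolding k by (simp add: reflect_def)
      qed
    qed
    have "reflect (pm_root i (-1) j) \<in> W_D" unfolding W_D_def
      using pm_root_in_Delta_D[of i j "-1"] j by (intro reflect_in_refl_group) auto
    moreover have "reflect (pm_root i (-1) j) (axis i 1) $ j = 1"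
      using j by (simp add: reflect_pm_root axis_def)
    ultimately show False using inv[of "reflect (pm_root i (-1) j)"] j unfolding W by auto
  qed
  then show ?thesis unfolding connected_mg_def by blast
qed

text \<open>Connectedness yields, for each pair of vertices, the reflection in one of the two roots
  on that pair. Independence yields one pair with both roots, and conjugation spreads this to all
  pairs.\<close>

lemma connected_imp_refl_group_W_D:
  fixes g :: "'n::finite \<Rightarrow> real^'n"
  assumes fam: "is_family g" and g: "Delta_family g" and con: "connected_mg UNIV (fam_ends g)"
  shows "refl_group (range g) = W_D"
proof (rule equalityI[OF Delta_family_refl_group_subset[OF g]])
  define sgns where "sgns = {1, -1 :: real}"
  have sgns: "s = 1 \<or> s = -1" if "s \<in> sgns" for s using that unfolding sgns_def by auto
  have sgn_mult: "- s * t \<in> sgns" "s * s = 1" if "s \<in> sgns" "t \<in> sgns" for s t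
    using that unfolding sgns_def by auto
  define R where "R i s j \<longleftrightarrow> reflect (pm_root i s j) \<in> refl_group (range g)" for i s j
  have sym: "R j s i" if "R i s j" "s \<in> sgns" for i s j
    using that sgns[of s] unfolding R_def by (auto simp: pm_root_swap[of s j i] reflect_scaleR reflect_uminus)
  \<comment> \<open>The reflection in \<open>h_i + s h_j\<close> sends \<open>h_j + t h_k\<close> to
    \<open>-s (h_i - s t h_k)\<close>; hence the sign \<open>- s * t\<close> for a path of two
    edges.\<close>
  have trans: "R i (- s * t) k" if "R i s j" "R j t k" "i \<noteq> j" "j \<noteq> k" "i \<noteq> k" "s \<in> sgns" "t \<in> sgns"
    for i s j t k
  proof -
    have "reflect (pm_root i s j) (pm_root j t k) = (- s) *\<^sub>R pm_root i (- s * t) k"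
    proof -
      have "reflect (pm_root i s j) (pm_root j t k) $ l = ((- s) *\<^sub>R pm_root i (- s * t) k) $ l" for l
        using that(3-5) sgns[OF that(6)] by (auto simp: reflect_pm_root) (auto simp: pm_root_def axis_def)
      then show ?thesis by (simp add: vec_eq_iff)
    qed
    moreover have "reflect (pm_root i s j) \<circ> reflect (pm_root j t k) \<circ> reflect (pm_root i s j) \<in> refl_group (range g)"
      using that(1,2) unfolding R_def by (intro refl_group_comp)
    moreover have "- s \<noteq> 0" using sgns[OF that(6)] by auto
    ultimately show ?thesis unfolding R_def by (metis reflect_reflect reflect_scaleR)
  qed
  have edge: "R i t j" if "g k = c *\<^sub>R pm_root i t j" "c \<noteq> 0" for k i t j c
  proof -
    have "reflect (g k) \<in> refl_group (range g)" by (rule reflect_in_refl_group) simp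
    then show ?thesis unfolding R_def that(1) using that(2) by (simp add: reflect_scaleR)
  qed
  have reach: "\<exists>s\<in>sgns. R i s j" if "i \<noteq> j" for i j
  proof -
    have "(i, j) \<in> (mg_adj UNIV (fam_ends g))\<^sup>*" using con unfolding connected_mg_def by blast
    then have "j = i \<or> (\<exists>s\<in>sgns. R i s j)"
    proof induction
      case base then show ?case by blast
    next
      case (step y z)
      then obtain k where k: "fam_ends g k = {y, z}" unfolding mg_adj_def by blast
      have yz: "y \<noteq> z" using Delta_family_card_ends[OF g, of k] k by auto
      obtain t c where tc: "t = 1 \<or> t = -1" "c \<noteq> 0" "g k = c *\<^sub>R pm_root y t z"
        by (rule Delta_family_edge[OF g k yz])
      have t: "t \<in> sgns" "R y t z" using tc(1) edge[OF tc(3,2)] unfolding sgns_def by auto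
      show ?case
      proof (cases "y = i \<or> z = i")
        case True
        then show ?thesis using t by blast
      next
        case False
        then obtain s where "s \<in> sgns" "R i s y" using step.IH by blast
        then show ?thesis using trans[of i s y t z] t yz False sgn_mult(1) by blast
      qed
    qed
    then show ?thesis using that by blast
  qed
  \<comment> \<open>Linear independence enters here: if every pair carried one sign only, these
    signs would define a nonzero vector orthogonal to all normals.\<close>
  have "\<exists>i j. i \<noteq> j \<and> (\<forall>t\<in>sgns. R i t j)"
  proof (rule ccontr)
    assume neg: "\<not> ?thesis"
    have uniq: "s = t" if "R i s j" "R i t j" "i \<noteq> j" "s \<in> sgns" "t \<in> sgns" for i j s t
    proof (rule ccontr)
      assume "s \<noteq> t"
      then have "\<forall>u\<in>sgns. R i u j" using that unfolding sgns_def by auto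
      then show False using neg that(3) by blast
    qed
    fix i0 :: 'n
    have "\<forall>j. \<exists>s. i0 \<noteq> j \<longrightarrow> s \<in> sgns \<and> R i0 s j" using reach by blast
    then obtain s where s: "\<And>j. i0 \<noteq> j \<Longrightarrow> s j \<in> sgns \<and> R i0 (s j) j" by metis
    \<comment> \<open>Chosen orthogonal to \<open>h_i0 + s_j h_j\<close> for every \<open>j\<close>;
      uniqueness of signs and \<open>trans\<close> extend the orthogonality to all edges.\<close>
    define d :: "real^'n" where "d = (\<chi> j. if j = i0 then 1 else - s j)"
    have "d \<bullet> g k = 0" for k
    proof -
      obtain i j where k: "fam_ends g k = {i, j}" and ij: "i \<noteq> j"
        using Delta_family_card_ends[OF g, of k] by (meson card_2_iff)
      obtain t c where tc: "t = 1 \<or> t = -1" "c \<noteq> 0" "g k = c *\<^sub>R pm_root i t j"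
        by (rule Delta_family_edge[OF g k ij])
      have t: "t \<in> sgns" "R i t j" using tc(1) edge[OF tc(3,2)] unfolding sgns_def by auto
      have t2: "t * t = 1" using tc(1) by auto
      have "d $ i + t * d $ j = 0"
      proof -
        consider "i = i0" | "j = i0" | "i \<noteq> i0" "j \<noteq> i0" by blast
        then show ?thesis
        proof cases
          case 1
          then have "t = s j" using uniq[of i0 t j "s j"] t s[of j] ij by auto
          then show ?thesis using 1 ij t2 unfolding d_def by auto
        next
          case 2
          then have "t = s i" using uniq[of i0 t i "s i"] sym[OF t(2,1)] t(1) s[of i] ij by auto
          then show ?thesis using 2 ij unfolding d_def by auto
        next
          case 3
          have "R i0 (- s i * t) j" using trans[of i0 "s i" i t j] s[of i] t 3 ij by auto
          then have "s j = - s i * t" using uniq[of i0 "s j" j "- s i * t"] s[of j] s[of i] 3 sgn_mult(1) t(1) by auto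
          then show ?thesis using 3 t2 unfolding d_def by auto
        qed
      qed
      then show ?thesis unfolding tc(3) by (simp add: inner_pm_root)
    qed
    then have "d = 0" by (rule is_family_orthogonal_imp_zero[OF fam])
    then have "d $ i0 = 0" by simp
    then show False unfolding d_def by simp
  qed
  then obtain i j where ij: "i \<noteq> j" and both: "\<And>t. t \<in> sgns \<Longrightarrow> R i t j" by blast
  \<comment> \<open>A path from \<open>k\<close> through \<open>i\<close> to \<open>j\<close>, in
    which the free sign on the pair \<open>i\<close>, \<open>j\<close> is chosen to make the
    composite sign \<open>t\<close>.\<close>
  have star: "R k t j" if "k \<noteq> j" "t \<in> sgns" for k t
  proof (cases "k = i")
    case True
    then show ?thesis using both that by simp
  next
    case False
    then obtain u where u: "u \<in> sgns" "R k u i" using reach by blast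
    have "R k (- u * (- u * t)) j"
      using trans[OF u(2) both[of "- u * t"]] False ij that u(1) sgn_mult(1) by blast
    moreover have "- u * (- u * t) = t" using sgn_mult(2)[OF u(1) u(1)] by (simp add: mult.assoc[symmetric])
    ultimately show ?thesis by (simp only:)
  qed
  \<comment> \<open>Both signs are available from every vertex to \<open>j\<close>, so the remaining
    pairs are joined through \<open>j\<close>.\<close>
  have all: "R k t l" if "k \<noteq> l" "t \<in> sgns" for k t l
  proof (cases "l = j \<or> k = j")
    case True
    then show ?thesis using star[of k t] star[of l t] sym[of l t j] that by blast
  next
    case False
    have sg: "1 \<in> sgns" "- t \<in> sgns" using that(2) unfolding sgns_def by auto
    have "R j (- t) l" using star[of l "- t"] sym False sg by blast
    then have "R k (- 1 * (- t)) l" using trans[OF star[of k 1]] False sg that by blast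
    then show ?thesis by simp
  qed
  show "W_D \<subseteq> refl_group (range g)" unfolding W_D_def
  proof (rule refl_group_least)
    fix r :: "real^'n" assume "r \<in> Delta_D"
    then show "reflect r \<in> refl_group (range g)"
    proof (rule reflect_Delta_D)
      fix i j s assume "i \<noteq> j" "s = 1 \<or> s = -1" "reflect r = reflect (pm_root i s j)"
      then show ?thesis using all[of i j s] unfolding R_def sgns_def by simp
    qed
  qed
qed

section \<open>Isometries and signed graphs\<close>

lemma fam_isometric_sym:
  fixes f g :: "'n::finite \<Rightarrow> real^'n"
  assumes "fam_isometric f g"
  shows "fam_isometric g f"
proof -
  obtain T where T: "orthogonal_transformation T" "T ` pm_set f = pm_set g"
    using assms unfolding fam_isometric_def by blast
  have "inv T ` (T ` pm_set f) = pm_set f"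
    using orthogonal_transformation_inj[OF T(1)] by (simp add: image_inv_f_f)
  then show ?thesis unfolding fam_isometric_def T(2) using orthogonal_transformation_inv[OF T(1)] by blast
qed

lemma fam_isometric_trans:
  assumes "fam_isometric f g" "fam_isometric g h"
  shows "fam_isometric f h"
proof -
  obtain T where T: "orthogonal_transformation T" "T ` pm_set f = pm_set g"
    using assms(1) unfolding fam_isometric_def by blast
  obtain U where U: "orthogonal_transformation U" "U ` pm_set g = pm_set h"
    using assms(2) unfolding fam_isometric_def by blast
  have "(U \<circ> T) ` pm_set f = pm_set h" by (simp only: image_comp[symmetric] T(2) U(2))
  then show ?thesis unfolding fam_isometric_def
    using orthogonal_transformation_compose[OF U(1) T(1)] by blast
qed

lemma fam_isometric_refl: "fam_isometric f f"
  unfolding fam_isometric_def by (rule exI[of _ "\<lambda>x. x"]) simp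

lemma is_family_pm_eq:
  assumes f: "is_family f" and kl: "f k = f l \<or> f k = - f l"
  shows "k = l"
proof (rule ccontr)
  assume ne: "k \<noteq> l"
  have "f k \<noteq> f l" using f ne unfolding is_family_def by (auto dest: injD)
  then have "f l \<in> span (range f - {f k})" by (intro span_base) auto
  then have "- f l \<in> span (range f - {f k})" by (rule span_neg)
  moreover have "f k = - f l" using kl \<open>f k \<noteq> f l\<close> by blast
  ultimately have "f k \<in> span (range f - {f k})" by simp
  then have "dependent (range f)" unfolding dependent_def by blast
  then show False using f unfolding is_family_def by blast
qed

text \<open>Independence forbids two normals that agree up to sign, so an isometry of the symmetric
  sets induces a bijection of indices.\<close>

lemma fam_isometric_bij:
  fixes f g :: "'n::finite \<Rightarrow> real^'n"
  assumes f: "is_family f" and T: "orthogonal_transformation T" "T ` pm_set f = pm_set g"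
  obtains \<tau> where "bij \<tau>" "\<And>k. T (f k) = g (\<tau> k) \<or> T (f k) = - g (\<tau> k)"
proof -
  have "\<exists>l. T (f k) = g l \<or> T (f k) = - g l" for k
  proof -
    have "f k \<in> pm_set f" by (simp add: pm_set_def)
    then have "T (f k) \<in> pm_set g" using T(2) by blast
    then show ?thesis unfolding pm_set_def by blast
  qed
  then obtain \<tau> where \<tau>: "\<And>k. T (f k) = g (\<tau> k) \<or> T (f k) = - g (\<tau> k)" by metis
  have lin: "linear T" by (rule orthogonal_transformation_linear[OF T(1)])
  have "inj \<tau>"
  proof (rule injI)
    fix k l assume "\<tau> k = \<tau> l"
    then have "T (f k) = T (f l) \<or> T (f k) = - T (f l)" using \<tau>[of k] \<tau>[of l] by auto
    then have "T (f k) = T (f l) \<or> T (f k) = T (- f l)" by (simp add: linear_neg[OF lin])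
    then have "f k = f l \<or> f k = - f l" using orthogonal_transformation_inj[OF T(1)] by (simp add: inj_eq)
    then show "k = l" by (rule is_family_pm_eq[OF f])
  qed
  then have "bij \<tau>" by (simp add: bij_def finite_UNIV_inj_surj)
  then show thesis using \<tau> that by blast
qed

lemma fam_isometricI:
  assumes T: "orthogonal_transformation T" and "bij \<tau>"
    and eq: "\<And>k. T (f k) = g (\<tau> k) \<or> T (f k) = - g (\<tau> k)"
  shows "fam_isometric f g"
proof -
  have lin: "linear T" by (rule orthogonal_transformation_linear[OF T])
  have "T ` pm_set f = pm_set g"
  proof (intro equalityI subsetI)
    fix x assume "x \<in> T ` pm_set f"
    then obtain y where y: "x = T y" "y \<in> pm_set f" by blast
    then obtain k where "y = f k \<or> y = - f k" unfolding pm_set_def by blast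
    then have "x = T (f k) \<or> x = - T (f k)" using y(1) linear_neg[OF lin] by auto
    then show "x \<in> pm_set g" using eq[of k] unfolding pm_set_def by auto
  next
    fix x assume "x \<in> pm_set g"
    then obtain l where l: "x = g l \<or> x = - g l" unfolding pm_set_def by auto
    obtain k where k: "l = \<tau> k" using \<open>bij \<tau>\<close> by (metis bij_pointE)
    have "x = T (f k) \<or> x = T (- f k)" using l eq[of k] k by (auto simp: linear_neg[OF lin])
    moreover have "f k \<in> pm_set f" "- f k \<in> pm_set f" unfolding pm_set_def by auto
    ultimately show "x \<in> T ` pm_set f" by blast
  qed
  then show ?thesis using T unfolding fam_isometric_def by blast
qed

lemma unit_scaleR_pm_eq:
  fixes r :: "'a::real_normed_vector"
  assumes "norm a = 1" "norm b = 1" "a = c *\<^sub>R r" "b = c' *\<^sub>R r"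
  shows "a = b \<or> a = - b"
proof -
  have "\<bar>c\<bar> * norm r = \<bar>c'\<bar> * norm r" "norm r \<noteq> 0" using assms by auto
  then have "\<bar>c\<bar> = \<bar>c'\<bar>" by simp
  then have "c = c' \<or> c = - c'" by (simp add: abs_eq_iff)
  then show ?thesis using assms(3,4) by auto
qed

section \<open>Isomorphisms of multigraphs\<close>

lemma mg_iso_sym:
  assumes "mg_iso E ends E' ends'"
  shows "mg_iso E' ends' E ends"
proof -
  obtain \<sigma> \<tau> where *: "bij \<sigma>" "bij_betw \<tau> E E'" "\<forall>e\<in>E. ends' (\<tau> e) = \<sigma> ` ends e"
    using assms unfolding mg_iso_def by blast
  have "ends (inv_into E \<tau> e) = inv \<sigma> ` ends' e" if "e \<in> E'" for e
  proof -
    have e: "inv_into E \<tau> e \<in> E" "\<tau> (inv_into E \<tau> e) = e"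
      using *(2) that by (simp_all add: bij_betw_def f_inv_into_f inv_into_into)
    then have "ends' e = \<sigma> ` ends (inv_into E \<tau> e)" using *(3) by metis
    then show ?thesis using *(1) by (simp add: bij_is_inj image_inv_f_f)
  qed
  then show ?thesis unfolding mg_iso_def
    using bij_imp_bij_inv[OF *(1)] bij_betw_inv_into[OF *(2)] by blast
qed

lemma mg_iso_trans:
  assumes "mg_iso E ends E' ends'" "mg_iso E' ends' E'' ends''"
  shows "mg_iso E ends E'' ends''"
proof -
  obtain \<sigma> \<tau> where 1: "bij \<sigma>" "bij_betw \<tau> E E'" "\<forall>e\<in>E. ends' (\<tau> e) = \<sigma> ` ends e"
    using assms(1) unfolding mg_iso_def by blast
  obtain \<sigma>' \<tau>' where 2: "bij \<sigma>'" "bij_betw \<tau>' E' E''" "\<forall>e\<in>E'. ends'' (\<tau>' e) = \<sigma>' ` ends' e"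
    using assms(2) unfolding mg_iso_def by blast
  have "ends'' ((\<tau>' \<circ> \<tau>) e) = (\<sigma>' \<circ> \<sigma>) ` ends e" if "e \<in> E" for e
  proof -
    have "\<tau> e \<in> E'" using 1(2) that by (rule bij_betwE[rule_format])
    then show ?thesis using 1(3) 2(3) that by (simp add: image_image)
  qed
  then show ?thesis unfolding mg_iso_def
    using bij_comp[OF 1(1) 2(1)] bij_betw_trans[OF 1(2) 2(2)] by blast
qed

text \<open>The edges of the form \<open>h_i + h_j\<close>: the product of the two nonzero
  coordinates does not change when the normal is negated.\<close>

definition pos_edges :: "('n \<Rightarrow> real^'n) \<Rightarrow> 'n set" where
  "pos_edges g = {k. 0 < (\<Prod>i\<in>fam_ends g k. g k $ i)}"

lemma fam_ends_pm_root:
  assumes "g k = c *\<^sub>R pm_root y t z" "c \<noteq> 0" "y \<noteq> z" "t = 1 \<or> t = -1"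
  shows "fam_ends g k = {y, z}"
  unfolding fam_ends_def assms(1) pm_root_def using assms(2-4) by (auto simp: axis_def)

lemma mem_pos_edges_iff:
  assumes "g k = c *\<^sub>R pm_root y t z" "c \<noteq> 0" "y \<noteq> z" "t = 1 \<or> t = -1"
  shows "k \<in> pos_edges g \<longleftrightarrow> t = 1"
proof -
  have "g k $ y = c" "g k $ z = c * t"
    unfolding assms(1) pm_root_def using assms(3) by (auto simp: axis_def)
  then have "(\<Prod>i\<in>fam_ends g k. g k $ i) = c\<^sup>2 * t"
    unfolding fam_ends_pm_root[of g, OF assms] using assms(3) by (simp add: power2_eq_square)
  then show ?thesis using assms(2,4) unfolding pos_edges_def by auto
qed

lemma Delta_familyE:
  assumes "Delta_family g"
  obtains y z t c where "y \<noteq> z" "t = 1 \<or> t = -1" "c \<noteq> 0" "g k = c *\<^sub>R pm_root y t z" "fam_ends g k = {y, z}"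
proof -
  obtain y z where yz: "fam_ends g k = {y, z}" "y \<noteq> z"
    using Delta_family_card_ends[OF assms, of k] by (meson card_2_iff)
  obtain t c where "t = 1 \<or> t = -1" "c \<noteq> 0" "g k = c *\<^sub>R pm_root y t z"
    by (rule Delta_family_edge[OF assms yz])
  then show thesis using that yz by blast
qed

text \<open>If the positive edges formed the cut of \<open>A\<close>, the vector with entries 1 on
  \<open>A\<close> and -1 elsewhere would be orthogonal to every normal.\<close>

lemma pos_edges_not_cut:
  fixes g :: "'n::finite \<Rightarrow> real^'n"
  assumes fam: "is_family g" and g: "Delta_family g"
  shows "pos_edges g \<notin> range (cut UNIV (fam_ends g))"
proof
  assume "pos_edges g \<in> range (cut UNIV (fam_ends g))"
  then obtain A where A: "pos_edges g = cut UNIV (fam_ends g) A" by blast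
  define d :: "real^'n" where "d = (\<chi> i. if i \<in> A then 1 else -1)"
  have "d \<bullet> g k = 0" for k
  proof -
    obtain y z t c where k: "y \<noteq> z" "t = 1 \<or> t = -1" "c \<noteq> 0" "g k = c *\<^sub>R pm_root y t z" "fam_ends g k = {y, z}"
      by (rule Delta_familyE[OF g])
    have "t = 1 \<longleftrightarrow> (y \<in> A \<longleftrightarrow> z \<notin> A)"
      using mem_pos_edges_iff[of g, OF k(4,3,1,2)] mem_cut_iff[of k UNIV "fam_ends g", OF UNIV_I k(5,1)]
      unfolding A by simp
    then have "d $ y + t * d $ z = 0" using k(2) unfolding d_def by auto
    then show ?thesis unfolding k(4) by (simp add: inner_pm_root)
  qed
  then have "d = 0" by (rule is_family_orthogonal_imp_zero[OF fam])
  \<comment> \<open>An arbitrary coordinate serves, as all of them are 1 or -1.\<close>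
  then have "d $ undefined = 0" by simp
  then show False unfolding d_def by (simp split: if_splits)
qed

lemma signed_permutation_orthogonal:
  fixes \<sigma> :: "'n::finite \<Rightarrow> 'n" and \<epsilon> :: "'n \<Rightarrow> real"
  assumes \<sigma>: "bij \<sigma>" and \<epsilon>: "\<And>i. \<epsilon> i = 1 \<or> \<epsilon> i = -1"
  obtains T :: "real^'n \<Rightarrow> real^'n"
    where "orthogonal_transformation T" "\<And>i. T (axis i 1) = \<epsilon> i *\<^sub>R axis (\<sigma> i) 1"
proof
  define T :: "real^'n \<Rightarrow> real^'n" where "T x = (\<chi> i. \<epsilon> (inv \<sigma> i) * x $ inv \<sigma> i)" for x
  have "linear T" by (rule linearI) (auto simp: T_def vec_eq_iff algebra_simps)
  moreover have "T v \<bullet> T w = v \<bullet> w" for v w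
  proof -
    have e: "\<epsilon> j * \<epsilon> j = 1" for j using \<epsilon>[of j] by auto
    have sq: "\<epsilon> j * a * (\<epsilon> j * b) = a * b" for j a b
      using e[of j] by (metis mult.left_commute mult.assoc mult_1)
    have "T v \<bullet> T w = (\<Sum>i\<in>UNIV. v $ inv \<sigma> i * w $ inv \<sigma> i)"
      unfolding inner_vec_def T_def inner_real_def vec_lambda_beta sq ..
    also have "\<dots> = (\<Sum>i\<in>UNIV. v $ i * w $ i)"
      by (rule sum.reindex_bij_betw[OF bij_imp_bij_inv[OF \<sigma>]])
    finally show ?thesis by (simp add: inner_vec_def)
  qed
  ultimately show "orthogonal_transformation T" unfolding orthogonal_transformation_def by blast
  show "T (axis i 1) = \<epsilon> i *\<^sub>R axis (\<sigma> i) 1" for i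
  proof -
    have "T (axis i 1) $ k = (\<epsilon> i *\<^sub>R axis (\<sigma> i) 1) $ k" for k
    proof (cases "k = \<sigma> i")
      case True
      then have "inv \<sigma> k = i" using \<sigma> by (simp add: bij_is_inj)
      then show ?thesis unfolding T_def True by simp
    next
      case False
      then have "inv \<sigma> k \<noteq> i" using \<sigma> by (metis bij_inv_eq_iff)
      then show ?thesis unfolding T_def using False by (simp add: axis_def)
    qed
    then show ?thesis by (simp add: vec_eq_iff)
  qed
qed

text \<open>After transport along the isomorphism both sign patterns are non-cuts of one graph, so
  they differ by a cut. Negating the basis vectors on one side of that cut corrects the
  difference.\<close>

lemma mg_iso_imp_fam_isometric:
  fixes g h :: "'n::finite \<Rightarrow> real^'n"
  assumes g: "is_family g" "Delta_family g" and h: "is_family h" "Delta_family h"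
    and con: "connected_mg UNIV (fam_ends g)"
    and iso: "mg_iso UNIV (fam_ends g) UNIV (fam_ends h)"
  shows "fam_isometric g h"
proof -
  obtain \<sigma> \<tau> where \<sigma>: "bij \<sigma>" and \<tau>: "bij \<tau>" and ends: "\<And>k. fam_ends h (\<tau> k) = \<sigma> ` fam_ends g k"
    using iso unfolding mg_iso_def by blast
  define S where "S = \<tau> -` pos_edges h"
  \<comment> \<open>An isomorphism carries cuts to cuts, so the transported pattern of
    \<open>h\<close> is again a non-cut.\<close>
  have "S \<notin> range (cut UNIV (fam_ends g))"
  proof
    assume "S \<in> range (cut UNIV (fam_ends g))"
    then obtain A where A: "S = cut UNIV (fam_ends g) A" by blast
    have "pos_edges h = cut UNIV (fam_ends h) (\<sigma> ` A)"
    proof (rule set_eqI)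
      fix l
      obtain k where k: "l = \<tau> k" using \<tau> by (metis bij_pointE)
      have "l \<in> pos_edges h \<longleftrightarrow> card (A \<inter> fam_ends g k) = 1"
        using A unfolding S_def cut_def k by blast
      moreover have "\<sigma> ` A \<inter> fam_ends h l = \<sigma> ` (A \<inter> fam_ends g k)"
        unfolding k ends using \<sigma> by (simp add: image_Int bij_is_inj)
      moreover have "card (\<sigma> ` (A \<inter> fam_ends g k)) = card (A \<inter> fam_ends g k)"
        using \<sigma> by (intro card_image) (meson bij_is_inj inj_on_subset subset_UNIV)
      ultimately show "l \<in> pos_edges h \<longleftrightarrow> l \<in> cut UNIV (fam_ends h) (\<sigma> ` A)" unfolding cut_def by simp
    qed
    then show False using pos_edges_not_cut[OF h] by blast
  qed
  then have "sym_diff (pos_edges g) S \<in> range (cut UNIV (fam_ends g))"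
    using pos_edges_not_cut[OF g]
    by (intro sym_diff_not_cuts[OF Delta_family_loopless[OF g(2)] con]) auto
  then obtain A where A: "sym_diff (pos_edges g) S = cut UNIV (fam_ends g) A" by blast
  \<comment> \<open>Negating the basis vectors in \<open>A\<close> changes the signs of exactly the
    edges in the cut of \<open>A\<close>.\<close>
  define \<epsilon> :: "'n \<Rightarrow> real" where "\<epsilon> i = (if i \<in> A then -1 else 1)" for i
  have \<epsilon>: "\<epsilon> i = 1 \<or> \<epsilon> i = -1" for i unfolding \<epsilon>_def by simp
  obtain T :: "real^'n \<Rightarrow> real^'n"
    where T: "orthogonal_transformation T" "\<And>i. T (axis i 1) = \<epsilon> i *\<^sub>R axis (\<sigma> i) 1"
    by (rule signed_permutation_orthogonal[of \<sigma> \<epsilon>, OF \<sigma> \<epsilon>]) blast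
  have lin: "linear T" by (rule orthogonal_transformation_linear[OF T(1)])
  have "T (g k) = h (\<tau> k) \<or> T (g k) = - h (\<tau> k)" for k
  proof -
    obtain y z t c where k: "y \<noteq> z" "t = 1 \<or> t = -1" "c \<noteq> 0" "g k = c *\<^sub>R pm_root y t z" "fam_ends g k = {y, z}"
      by (rule Delta_familyE[OF g(2)])
    have "fam_ends h (\<tau> k) = {\<sigma> y, \<sigma> z}" "\<sigma> y \<noteq> \<sigma> z"
      using ends[of k] k(1,5) \<sigma> by (auto simp: bij_is_inj inj_eq)
    then obtain t' c' where l: "t' = 1 \<or> t' = -1" "c' \<noteq> 0" "h (\<tau> k) = c' *\<^sub>R pm_root (\<sigma> y) t' (\<sigma> z)"
      using Delta_family_edge[OF h(2), of "\<tau> k" "\<sigma> y" "\<sigma> z"] by metis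
    have "k \<in> cut UNIV (fam_ends g) A \<longleftrightarrow> (t = 1) \<noteq> (t' = 1)"
      using mem_pos_edges_iff[of g, OF k(4,3,1,2)] mem_pos_edges_iff[of h, OF l(3,2) \<open>\<sigma> y \<noteq> \<sigma> z\<close> l(1)]
      unfolding A[symmetric] S_def by auto
    moreover have "k \<in> cut UNIV (fam_ends g) A \<longleftrightarrow> (y \<in> A \<longleftrightarrow> z \<notin> A)"
      by (rule mem_cut_iff[of k UNIV "fam_ends g", OF UNIV_I k(5,1)])
    ultimately have "\<epsilon> y * (t * \<epsilon> z) = t'"
      using k(2) l(1) unfolding \<epsilon>_def by (cases "y \<in> A"; cases "z \<in> A") auto
    moreover have "\<epsilon> y * \<epsilon> y = 1" unfolding \<epsilon>_def by simp
    ultimately have "t * \<epsilon> z = \<epsilon> y * t'" by (metis mult.assoc mult_1)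
    then have "T (g k) = (c * \<epsilon> y) *\<^sub>R pm_root (\<sigma> y) t' (\<sigma> z)"
      unfolding k(4) pm_root_def by (simp add: linear_add[OF lin] linear_cmul[OF lin] T(2) algebra_simps)
    moreover have "norm (T (g k)) = 1" "norm (h (\<tau> k)) = 1"
      using g(1) h(1) orthogonal_transformation_norm[OF T(1)] unfolding is_family_def by auto
    ultimately show ?thesis using unit_scaleR_pm_eq l(3) by blast
  qed
  then show ?thesis by (rule fam_isometricI[OF T(1) \<tau>])
qed

text \<open>There are as many edges as coordinates, so edges can index the normals. The signs come
  from a non-cut, which makes the normals independent: a nonzero vector orthogonal to all of them
  would exhibit the pattern as a cut.\<close>

lemma ex_Delta_family:
  fixes ends :: "'e \<Rightarrow> 'n::finite set"
  assumes M: "in_M E ends"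
  obtains g :: "'n \<Rightarrow> real^'n"
    where "is_family g" "Delta_family g" "connected_mg UNIV (fam_ends g)" "mg_iso UNIV (fam_ends g) E ends"
proof -
  have E: "loopless_mg E ends" "connected_mg E ends" "card E = CARD('n)" using M unfolding in_M_iff by auto
  then obtain \<tau> :: "'n \<Rightarrow> 'e" where \<tau>: "bij_betw \<tau> UNIV E"
    using finite_same_card_bij[of "UNIV :: 'n set" E] unfolding loopless_mg_def by auto
  define ends' where "ends' = ends \<circ> \<tau>"
  have two: "card (ends' k) = 2" for k
    using E(1) bij_betwE[OF \<tau>] unfolding loopless_mg_def ends'_def by auto
  then have loop: "loopless_mg UNIV ends'" unfolding loopless_mg_def by simp
  have "mg_adj E ends = mg_adj UNIV ends'"
    using \<tau> unfolding mg_adj_def ends'_def bij_betw_def by force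
  then have con: "connected_mg UNIV ends'" using E(2) unfolding connected_mg_def by simp
  obtain S where S: "S \<notin> range (cut UNIV ends')" using ex_not_cut[OF loop con] by auto
  have "\<forall>k. \<exists>y z. ends' k = {y, z} \<and> y \<noteq> z" using two by (meson card_2_iff)
  then obtain y z where yz: "\<And>k. ends' k = {y k, z k}" "\<And>k. y k \<noteq> z k" by metis
  define t :: "'n \<Rightarrow> real" where "t k = (if k \<in> S then 1 else -1)" for k
  have t: "t k = 1 \<or> t k = -1" for k unfolding t_def by simp
  define g :: "'n \<Rightarrow> real^'n" where "g k = (1 / sqrt 2) *\<^sub>R pm_root (y k) (t k) (z k)" for k
  have ends: "fam_ends g = ends'"
  proof
    fix k show "fam_ends g k = ends' k"
      unfolding yz(1) by (rule fam_ends_pm_root[OF g_def]) (use yz(2) t in auto)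
  qed
  have D: "Delta_family g" unfolding Delta_family_def g_def using pm_root_in_Delta_D[OF yz(2) t] by simp
  have fam: "is_family g"
  proof (rule is_family_if_orthogonal_zero)
    fix k
    have "pm_root (y k) (t k) (z k) \<bullet> pm_root (y k) (t k) (z k) = 2"
      using yz(2)[of k] t[of k] by (auto simp: inner_pm_root) (auto simp: pm_root_def axis_def)
    then have "norm (pm_root (y k) (t k) (z k)) = sqrt 2" by (simp add: norm_eq_sqrt_inner)
    then show "norm (g k) = 1" unfolding g_def by simp
  next
    fix x :: "real^'n" assume orth: "\<And>k. x \<bullet> g k = 0"
    have xk: "x $ y k = - t k * x $ z k" for k
      using orth[of k] unfolding g_def by (simp add: inner_pm_root)
    show "x = 0"
    proof (rule ccontr)
      assume "x \<noteq> 0"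
      then obtain i where i: "x $ i \<noteq> 0" by (auto simp: vec_eq_iff)
      \<comment> \<open>Orthogonality to a normal equates the absolute values at the two ends of its
        edge; connectedness carries this to all coordinates.\<close>
      have "\<bar>x $ j\<bar> = \<bar>x $ i\<bar>" for j
      proof -
        have "(i, j) \<in> (mg_adj UNIV ends')\<^sup>*" using con unfolding connected_mg_def by blast
        then show ?thesis
        proof induction
          case (step a b)
          then obtain k where "ends' k = {a, b}" unfolding mg_adj_def by auto
          then have "(a = y k \<and> b = z k) \<or> (a = z k \<and> b = y k)"
            unfolding yz(1) by (auto simp: doubleton_eq_iff)
          moreover have "\<bar>x $ y k\<bar> = \<bar>x $ z k\<bar>" using xk[of k] t[of k] by (auto simp: abs_mult)
          ultimately show ?case using step.IH by auto
        qed simp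
      qed
      then have nz: "x $ j \<noteq> 0" for j using i by (metis abs_eq_0)
      \<comment> \<open>Coordinates at the ends of an edge have opposite signs exactly when the edge
        is positive.\<close>
      have "S = cut UNIV ends' {j. 0 < x $ j}"
      proof (rule set_eqI)
        fix k
        have "t k = 1 \<longleftrightarrow> (0 < x $ y k \<longleftrightarrow> \<not> 0 < x $ z k)"
          using xk[of k] t[of k] nz[of "y k"] nz[of "z k"] by auto
        then show "k \<in> S \<longleftrightarrow> k \<in> cut UNIV ends' {j. 0 < x $ j}"
          using mem_cut_iff[of k UNIV ends' _ _ "{j. 0 < x $ j}", OF UNIV_I yz(1,2)]
          unfolding t_def by (auto split: if_splits)
      qed
      then show False using S by blast
    qed
  qed
  have "mg_iso UNIV (fam_ends g) E ends"
    unfolding mg_iso_def ends by (rule exI[of _ id], rule exI[of _ \<tau>]) (use \<tau> in \<open>auto simp: ends'_def\<close>)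
  then show thesis using that[OF fam D] con unfolding ends by blast
qed

section \<open>Dimension at least five\<close>

lemma Delta_D_norm: "r \<in> Delta_D \<Longrightarrow> norm r = sqrt 2"
proof (erule Delta_D_pm_rootE)
  fix i j s c assume r: "i \<noteq> j" "s = 1 \<or> s = -1" "c = 1 \<or> c = -1" "r = c *\<^sub>R pm_root i s j"
  have "pm_root i s j \<bullet> pm_root i s j = 2"
    using r(1,2) by (auto simp: inner_pm_root) (auto simp: pm_root_def axis_def)
  then show "norm r = sqrt 2" using r(3) unfolding r(4) by (auto simp: norm_eq_sqrt_inner)
qed

lemma Delta_D_component: "r \<in> Delta_D \<Longrightarrow> r $ i = 0 \<or> \<bar>r $ i\<bar> = 1"
  unfolding Delta_D_iff by metis

text \<open>The isometry conjugates \<open>W_D\<close> to itself, so the reflection in the image of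
  a root again lies in \<open>W_D\<close>. The root is first scaled to unit length, as
  \<open>reflect_in_W_D_imp\<close> requires.\<close>

lemma isometry_preserves_Delta_D:
  fixes g h :: "'n::finite \<Rightarrow> real^'n"
  assumes g: "refl_group (range g) = W_D" and h: "refl_group (range h) = W_D"
    and T: "orthogonal_transformation T" "T ` pm_set g = pm_set h" and r: "r \<in> Delta_D"
  shows "T r \<in> Delta_D"
proof -
  let ?s = "(1 / sqrt 2) *\<^sub>R r"
  have lin: "linear T" by (rule orthogonal_transformation_linear[OF T(1)])
  have "reflect r \<in> refl_group (pm_set g)"
    unfolding refl_group_pm_set g unfolding W_D_def by (rule reflect_in_refl_group[OF r])
  then have "T \<circ> reflect r \<circ> inv T \<in> refl_group (T ` pm_set g)"
    unfolding refl_group_image[OF T(1)] by (rule imageI)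
  then have "T \<circ> reflect r \<circ> inv T \<in> W_D" unfolding T(2) refl_group_pm_set h .
  moreover have "T \<circ> reflect r \<circ> inv T = reflect (T r)"
  proof -
    have "T \<circ> inv T = id" using orthogonal_transformation_surj[OF T(1)] by (simp flip: surj_iff)
    then show ?thesis
      unfolding reflect_comp_orthogonal[OF T(1), symmetric] comp_assoc by simp
  qed
  moreover have "reflect (T ?s) = reflect (T r)" unfolding linear_cmul[OF lin] by (simp add: reflect_scaleR)
  ultimately have "reflect (T ?s) \<in> W_D" by simp
  moreover have "norm (T ?s) = 1"
    unfolding orthogonal_transformation_norm[OF T(1)] by (simp add: Delta_D_norm[OF r])
  ultimately have "sqrt 2 *\<^sub>R T ?s \<in> Delta_D" by (intro reflect_in_W_D_imp)
  then show ?thesis unfolding linear_cmul[OF lin] by simp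
qed

text \<open>In dimension four the half-integral vectors \<open>(\<plusminus>1, \<plusminus>1, \<plusminus>1, \<plusminus>1) / 2\<close> are unit weights as well,
  which is the source of triality.\<close>
lemma unit_weight_is_axis:
  fixes v :: "real^'n::finite"
  assumes card: "CARD('n) \<ge> 5" and norm: "norm v = 1" and int: "\<And>r. r \<in> Delta_D \<Longrightarrow> v \<bullet> r \<in> \<int>"
  shows "\<exists>j. v = axis j 1 \<or> v = - axis j 1"
proof -
  have sum: "(\<Sum>k\<in>UNIV. (v $ k)\<^sup>2) = 1"
    using norm by (simp add: norm_eq_1 inner_vec_def power2_eq_square)
  have pm: "v $ i + v $ j \<in> \<int>" "v $ i - v $ j \<in> \<int>" if "i \<noteq> j" for i j
    using int[OF pm_root_in_Delta_D[OF that, of 1]] int[OF pm_root_in_Delta_D[OF that, of "-1"]]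
    by (simp_all add: inner_pm_root)
  show ?thesis
  \<comment> \<open>Since sums of two coordinates are integral, one integral coordinate makes all of
    them integral.\<close>
  proof (cases "\<exists>i. v $ i \<in> \<int>")
    case True
    then obtain i where i: "v $ i \<in> \<int>" by blast
    have ints: "v $ k \<in> \<int>" for k
      using Ints_diff[OF pm(1)[of i k] i] i by (cases "i = k") auto
    have "v \<noteq> 0" using norm by auto
    then obtain j where j: "v $ j \<noteq> 0" by (auto simp: vec_eq_iff)
    have "\<bar>v $ j\<bar> \<ge> 1" using ints j by (intro Ints_nonzero_abs_ge1)
    then have sq: "(v $ j)\<^sup>2 \<ge> 1" using power_mono[of 1 "\<bar>v $ j\<bar>" 2] by simp
    have split: "(v $ j)\<^sup>2 + (\<Sum>k\<in>UNIV - {j}. (v $ k)\<^sup>2) = 1"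
      using sum by (subst (asm) sum.remove[of _ j]) auto
    have "(\<Sum>k\<in>UNIV - {j}. (v $ k)\<^sup>2) \<ge> 0" by (intro sum_nonneg) auto
    then have "(v $ j)\<^sup>2 = 1" and "(\<Sum>k\<in>UNIV - {j}. (v $ k)\<^sup>2) = 0" using sq split by linarith+
    then have "v $ j = 1 \<or> v $ j = -1" and z: "\<And>k. k \<noteq> j \<Longrightarrow> v $ k = 0"
      by (simp_all add: power2_eq_1_iff sum_nonneg_eq_0_iff)
    then have "v = axis j 1 \<or> v = - axis j 1" by (auto simp: vec_eq_iff axis_def)
    then show ?thesis by blast
  next
    case False
    \<comment> \<open>Twice each coordinate is a nonzero integer. Five or more squares of at least
      1/4 exceed the squared norm 1.\<close>
    have "(v $ i)\<^sup>2 \<ge> 1 / 4" for i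
    proof -
      have "\<exists>j. j \<noteq> i"
      proof (rule ccontr)
        assume "\<not> ?thesis"
        then have "UNIV = {i}" by auto
        then have "CARD('n) = card {i}" by (rule arg_cong)
        then show False using card by simp
      qed
      then obtain j where "j \<noteq> i" by blast
      then have "(v $ i + v $ j) + (v $ i - v $ j) \<in> \<int>"
        using Ints_add[OF pm(1)[of i j] pm(2)[of i j]] by blast
      then have "2 * v $ i \<in> \<int>" by simp
      moreover have "v $ i \<noteq> 0" using False by (metis Ints_0)
      ultimately have "\<bar>2 * v $ i\<bar> \<ge> 1" by (intro Ints_nonzero_abs_ge1) auto
      then have "1 \<le> (2 * v $ i)\<^sup>2" using power_mono[of 1 "\<bar>2 * v $ i\<bar>" 2] by simp
      then show ?thesis by (simp add: power_mult_distrib)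
    qed
    then have "(\<Sum>k\<in>(UNIV :: 'n set). 1 / 4) \<le> (\<Sum>k\<in>UNIV. (v $ k)\<^sup>2)" by (intro sum_mono)
    then have "real CARD('n) \<le> 4" using sum by simp
    then show ?thesis using card by linarith
  qed
qed

text \<open>The inner product of the image of \<open>h_i\<close> with a root is a coordinate of the
  pulled-back root, hence an integer. So \<open>unit_weight_is_axis\<close> makes the isometry a
  signed permutation, and the underlying permutation of vertices is a graph isomorphism.\<close>

lemma fam_isometric_imp_mg_iso_ge5:
  fixes g h :: "'n::finite \<Rightarrow> real^'n"
  assumes card: "CARD('n) \<ge> 5" and fam: "is_family g"
    and g: "refl_group (range g) = W_D" and h: "refl_group (range h) = W_D"
    and iso: "fam_isometric g h"
  shows "mg_iso UNIV (fam_ends g) UNIV (fam_ends h)"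
proof -
  obtain T where T: "orthogonal_transformation T" "T ` pm_set g = pm_set h"
    using iso unfolding fam_isometric_def by blast
  have bijT: "bij T" by (rule orthogonal_transformation_bij[OF T(1)])
  have Ti: "orthogonal_transformation (inv T)" by (rule orthogonal_transformation_inv[OF T(1)])
  have Tim: "inv T ` pm_set h = pm_set g"
    unfolding T(2)[symmetric] using bijT by (simp add: bij_is_inj image_inv_f_f)
  have inner: "T x \<bullet> T y = x \<bullet> y" for x y using T(1) unfolding orthogonal_transformation_def by blast
  have "\<exists>j. T (axis i 1) = axis j 1 \<or> T (axis i 1) = - axis j 1" for i
  proof (rule unit_weight_is_axis[OF card])
    show "norm (T (axis i 1)) = 1" by (simp add: orthogonal_transformation_norm[OF T(1)] norm_axis_1)
    fix r :: "real^'n" assume "r \<in> Delta_D"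
    then have "inv T r \<in> Delta_D" by (rule isometry_preserves_Delta_D[OF h g Ti Tim])
    then have "inv T r $ i = 0 \<or> inv T r $ i = 1 \<or> inv T r $ i = -1"
      using Delta_D_component[of "inv T r" i] by linarith
    then have "inv T r $ i \<in> \<int>" by auto
    moreover have "T (axis i 1) \<bullet> T (inv T r) = inv T r $ i" unfolding inner by (simp add: inner_axis')
    ultimately show "T (axis i 1) \<bullet> r \<in> \<int>" using bijT by (simp add: bij_is_surj surj_f_inv_f)
  qed
  then obtain \<sigma> where \<sigma>: "\<And>i. T (axis i 1) = axis (\<sigma> i) 1 \<or> T (axis i 1) = - axis (\<sigma> i) 1" by metis
  have comp: "T x $ \<sigma> i = 0 \<longleftrightarrow> x $ i = 0" for x i
  proof -
    have "T x \<bullet> T (axis i 1) = x $ i" unfolding inner by (simp add: inner_axis)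
    moreover have "T x \<bullet> axis (\<sigma> i) 1 = T x $ \<sigma> i" by (simp add: inner_axis)
    ultimately have "x $ i = T x $ \<sigma> i \<or> x $ i = - (T x $ \<sigma> i)" using \<sigma>[of i] by auto
    then show ?thesis by auto
  qed
  have "inj \<sigma>"
  proof (rule injI)
    fix i j assume "\<sigma> i = \<sigma> j"
    then have "(axis i 1 :: real^'n) $ i = 0 \<longleftrightarrow> (axis i 1 :: real^'n) $ j = 0"
      using comp[of "axis i 1" i] comp[of "axis i 1" j] by simp
    then show "i = j" by (auto simp: axis_def split: if_splits)
  qed
  then have bij: "bij \<sigma>" by (simp add: bij_def finite_UNIV_inj_surj)
  obtain \<tau> where \<tau>: "bij \<tau>" "\<And>k. T (g k) = h (\<tau> k) \<or> T (g k) = - h (\<tau> k)"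
    using fam_isometric_bij[OF fam T] by metis
  have "fam_ends h (\<tau> k) = \<sigma> ` fam_ends g k" for k
  proof -
    have nz: "h (\<tau> k) $ m \<noteq> 0 \<longleftrightarrow> T (g k) $ m \<noteq> 0" for m using \<tau>(2)[of k] by auto
    have "h (\<tau> k) $ m \<noteq> 0 \<longleftrightarrow> m \<in> \<sigma> ` {i. g k $ i \<noteq> 0}" for m
    proof -
      obtain i where i: "m = \<sigma> i" using bij by (metis bij_pointE)
      show ?thesis unfolding nz i comp inj_image_mem_iff[OF \<open>inj \<sigma>\<close>] by simp
    qed
    then show ?thesis unfolding fam_ends_def by blast
  qed
  then show ?thesis unfolding mg_iso_def using bij \<tau>(1) by blast
qed

section \<open>Four vertices\<close>

text \<open>For \<open>x = 0, 1, 2\<close> these are all connected graphs on four vertices with four edges and a double edge.\<close>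
definition double_edge_model :: "nat \<Rightarrow> nat \<Rightarrow> nat set" where
  "double_edge_model x i = [{0, 1}, {0, 1}, {0, 2}, {3, x}] ! i"

text \<open>Numbering edges and vertices by 0 to 3 makes isomorphism a composition of enumerations
  and lets incidences be computed by evaluation.\<close>

definition modelled :: "('e \<Rightarrow> 'v set) \<Rightarrow> (nat \<Rightarrow> nat set) \<Rightarrow> bool" where
  "modelled ends M \<longleftrightarrow> (\<exists>e v. bij_betw e {..<4} UNIV \<and> bij_betw v {..<4} UNIV \<and>
     (\<forall>i<4. M i \<subseteq> {..<4} \<and> ends (e i) = v ` M i))"

lemma modelled_imp_mg_iso:
  assumes "modelled ends M" "modelled ends' M"
  shows "mg_iso UNIV ends UNIV ends'"
proof -
  obtain e v where 1: "bij_betw e {..<4} UNIV" "bij_betw v {..<4} UNIV"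
      "\<And>i. i < 4 \<Longrightarrow> M i \<subseteq> {..<4} \<and> ends (e i) = v ` M i"
    using assms(1) unfolding modelled_def by blast
  obtain e' v' where 2: "bij_betw e' {..<4} UNIV" "bij_betw v' {..<4} UNIV"
      "\<And>i. i < 4 \<Longrightarrow> M i \<subseteq> {..<4} \<and> ends' (e' i) = v' ` M i"
    using assms(2) unfolding modelled_def by blast
  define \<tau> where "\<tau> = e' \<circ> inv_into {..<4} e"
  define \<sigma> where "\<sigma> = v' \<circ> inv_into {..<4} v"
  have "ends' (\<tau> k) = \<sigma> ` ends k" for k
  proof -
    obtain i where i: "i < 4" "k = e i" using 1(1) unfolding bij_betw_def by auto
    have "inv_into {..<4} e k = i" using i 1(1) unfolding bij_betw_def by simp
    then have "ends' (\<tau> k) = v' ` M i" unfolding \<tau>_def using 2(3)[OF i(1)] by simp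
    moreover have "inv_into {..<4} v ` v ` M i = M i"
      using 1(2) 1(3)[OF i(1)] unfolding bij_betw_def by (intro inv_into_image_cancel) auto
    ultimately show ?thesis unfolding \<sigma>_def i(2) using 1(3)[OF i(1)] by (metis image_comp)
  qed
  moreover have "bij \<tau>" unfolding \<tau>_def using bij_betw_trans[OF bij_betw_inv_into[OF 1(1)] 2(1)] .
  moreover have "bij \<sigma>" unfolding \<sigma>_def using bij_betw_trans[OF bij_betw_inv_into[OF 1(2)] 2(2)] .
  ultimately show ?thesis unfolding mg_iso_def by blast
qed

lemma UNIV4_cases:
  assumes "UNIV = {a, b, c, d}"
  shows "x = a \<or> x = b \<or> x = c \<or> x = d"
proof -
  have "x \<in> {a, b, c, d}" unfolding assms[symmetric] by (rule UNIV_I)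
  then show ?thesis by simp
qed

lemma UNIV4_obtain_last:
  assumes "CARD('a::finite) = 4" "distinct [a :: 'a, b, c]"
  obtains d where "distinct [a, b, c, d]" "UNIV = {a, b, c, d}"
proof -
  have "card (UNIV - {a, b, c}) = 1" using assms by (simp add: card_Diff_subset)
  then obtain d where d: "UNIV - {a, b, c} = {d}" by (auto simp: card_1_singleton_iff)
  then have "d \<in> UNIV - {a, b, c}" by simp
  then have "distinct [a, b, c, d]" using assms(2) by auto
  moreover have "UNIV = {a, b, c, d}" using d by blast
  ultimately show thesis by (rule that)
qed

lemma UNIV4_obtain_two:
  assumes "CARD('a::finite) = 4" "(a :: 'a) \<noteq> b"
  obtains c d where "distinct [a, b, c, d]" "UNIV = {a, b, c, d}"
proof -
  have "{a, b} \<noteq> UNIV"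
  proof
    assume "{a, b} = UNIV"
    then have "card {a, b} = CARD('a)" by (rule arg_cong)
    then show False using assms by simp
  qed
  then obtain c where "c \<notin> {a, b}" by blast
  then have "distinct [a, b, c]" using assms(2) by auto
  then show thesis using UNIV4_obtain_last[OF assms(1)] that by metis
qed

lemma card_2_memberE:
  assumes "card A = 2" "a \<in> A"
  obtains b where "A = {a, b}" "a \<noteq> b"
proof -
  obtain u w where uw: "A = {u, w}" "u \<noteq> w" using assms(1) by (meson card_2_iff)
  show thesis
  proof (cases "a = u")
    case True
    then show thesis using that[of w] uw by blast
  next
    case False
    then have "a = w" using assms(2) uw(1) by blast
    then show thesis using that[of u] uw by blast
  qed
qed

lemma connected_cut_nonempty:
  assumes "loopless_mg UNIV ends" "connected_mg UNIV ends" "a \<in> A" "b \<notin> A"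
  obtains k where "card (A \<inter> ends k) = 1"
proof -
  have "cut UNIV ends A \<noteq> {}" using cut_empty_imp[OF assms(1,2) _ assms(4)] assms(3) by blast
  then show thesis using that unfolding cut_def by blast
qed

text \<open>The doubled pair is joined to the rest by a third edge; its end in the pair is called
  \<open>a\<close>. The fourth edge must contain the vertex \<open>d\<close> still missing, and its
  other end distinguishes the three models.\<close>

lemma double_edge_classification:
  fixes ends :: "'n::finite \<Rightarrow> 'n set"
  assumes card: "CARD('n) = 4" and loop: "loopless_mg UNIV ends" and con: "connected_mg UNIV ends"
    and ninj: "\<not> inj ends"
  obtains x where "x \<in> {0, 1, 2}" "modelled ends (double_edge_model x)"
proof -
  have two: "card (ends k) = 2" for k using loop unfolding loopless_mg_def by simp
  obtain e0 e1 where e01: "e0 \<noteq> e1" "ends e0 = ends e1" using ninj unfolding inj_def by blast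
  obtain p q where pq: "ends e0 = {p, q}" "p \<noteq> q" using two by (meson card_2_iff)
  obtain r s where rs: "distinct [p, q, r, s]" "UNIV = {p, q, r, s}"
    by (rule UNIV4_obtain_two[OF card pq(2)])
  \<comment> \<open>Connectedness makes the cut around the doubled pair nonempty.\<close>
  have "r \<notin> {p, q}" using rs(1) by auto
  then obtain e2 where e2: "card ({p, q} \<inter> ends e2) = 1"
    using connected_cut_nonempty[OF loop con, of p "{p, q}" r] by blast
  then obtain a where a: "{p, q} \<inter> ends e2 = {a}" by (auto simp: card_1_singleton_iff)
  obtain b where b: "{p, q} = {a, b}" "a \<noteq> b"
  proof -
    have "a = p \<or> a = q" using a by blast
    then show thesis using that[of p] that[of q] pq(2) by (auto simp: insert_commute)
  qed
  have "a \<in> ends e2" using a by blast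
  then obtain c where c: "ends e2 = {a, c}" "a \<noteq> c" by (rule card_2_memberE[OF two])
  have "c \<noteq> b"
  proof
    assume "c = b"
    then have "{p, q} \<inter> ends e2 = {a, b}" using b(1) c(1) by simp
    then show False using a b(2) by auto
  qed
  have "distinct [a, b, c]" using b(2) c(2) \<open>c \<noteq> b\<close> by auto
  then obtain d where d: "distinct [a, b, c, d]" "UNIV = {a, b, c, d}"
    by (rule UNIV4_obtain_last[OF card])
  have e2ne: "e2 \<noteq> e0" "e2 \<noteq> e1" using e01 e2 pq two[of e0] by auto
  have "distinct [e0, e1, e2]" using e01(1) e2ne by auto
  then obtain e3 where e3: "distinct [e0, e1, e2, e3]" "UNIV = {e0, e1, e2, e3}"
    by (rule UNIV4_obtain_last[OF card])
  obtain k where k: "card ({d} \<inter> ends k) = 1"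
    using connected_cut_nonempty[OF loop con, of d "{d}" a] d by auto
  then have dk: "d \<in> ends k" by (metis Int_insert_left_if0 card.empty inf_bot_left zero_neq_one)
  have e0ab: "ends e0 = {a, b}" "ends e1 = {a, b}" using e01 pq b by auto
  then have "d \<notin> ends e0" "d \<notin> ends e1" "d \<notin> ends e2" using d c by auto
  then have "k = e3" using dk UNIV4_cases[OF e3(2), of k] by blast
  then have "d \<in> ends e3" using dk by simp
  then obtain w where w: "ends e3 = {d, w}" "d \<noteq> w" by (rule card_2_memberE[OF two])
  define e where "e = (!) [e0, e1, e2, e3]"
  define v where "v = (!) [a, b, c, d]"
  have e: "bij_betw e {..<4} UNIV" unfolding e_def
    by (rule bij_betw_nth[OF e3(1)]) (use e3(2) in auto)
  have v: "bij_betw v {..<4} UNIV" unfolding v_def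
    by (rule bij_betw_nth[OF d(1)]) (use d(2) in auto)
  have "w = a \<or> w = b \<or> w = c" using w(2) UNIV4_cases[OF d(2), of w] by blast
  \<comment> \<open>The number of the model is the position of \<open>w\<close> in the enumeration
    \<open>v\<close> of the vertices.\<close>
  then obtain x where x: "x \<in> {0, 1, 2}" "w = v x" unfolding v_def by force
  have "double_edge_model x i \<subseteq> {..<4} \<and> ends (e i) = v ` double_edge_model x i" if "i < 4" for i
  proof -
    have "i = 0 \<or> i = 1 \<or> i = 2 \<or> i = 3" using that by linarith
    then show ?thesis using x(1) e0ab c(1) w(1) unfolding x(2)
      unfolding double_edge_model_def e_def v_def by (elim disjE) (auto simp: numeral_3_eq_3)
  qed
  then have "modelled ends (double_edge_model x)" unfolding modelled_def using e v by blast
  then show thesis using that x(1) by blast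
qed

text \<open>Ordered pairs are counted, and parallel edges are left out because they share two ends.
  For a family in the root system this is the number of non-orthogonal pairs of distinct normals,
  hence an isometry invariant.\<close>

definition edge_incidences :: "('e::finite \<Rightarrow> 'v set) \<Rightarrow> nat" where
  "edge_incidences ends = (\<Sum>k\<in>UNIV. \<Sum>l\<in>UNIV. of_bool (k \<noteq> l \<and> card (ends k \<inter> ends l) = 1))"

lemma edge_incidences_double_edge_model:
  fixes ends :: "'n::finite \<Rightarrow> 'n set"
  assumes "modelled ends (double_edge_model x)" "x \<in> {0, 1, 2}"
  shows "edge_incidences ends = [10, 8, 6] ! x"
proof -
  obtain e v where e: "bij_betw e {..<4} UNIV" and v: "bij_betw v {..<4} UNIV"
    and ends: "\<And>i. i < 4 \<Longrightarrow> double_edge_model x i \<subseteq> {..<4} \<and> ends (e i) = v ` double_edge_model x i"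
    using assms(1) unfolding modelled_def by blast
  have "of_bool (e i \<noteq> e j \<and> card (ends (e i) \<inter> ends (e j)) = 1)
      = (of_bool (i \<noteq> j \<and> card (double_edge_model x i \<inter> double_edge_model x j) = 1) :: nat)"
    if "i < 4" "j < 4" for i j
  proof -
    have inj: "inj_on v {..<4}" using v by (rule bij_betw_imp_inj_on)
    have "ends (e i) \<inter> ends (e j) = v ` (double_edge_model x i \<inter> double_edge_model x j)"
      using ends that inj by (simp add: inj_on_image_Int[of v "{..<4}"])
    moreover have "card (v ` (double_edge_model x i \<inter> double_edge_model x j))
        = card (double_edge_model x i \<inter> double_edge_model x j)"
      using ends[OF that(1)] by (intro card_image inj_on_subset[OF inj]) auto
    moreover have "e i \<noteq> e j \<longleftrightarrow> i \<noteq> j"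
      using bij_betw_imp_inj_on[OF e] that by (auto simp: inj_on_def)
    ultimately show ?thesis by simp
  qed
  then have "edge_incidences ends =
    (\<Sum>i<4. \<Sum>j<4. of_bool (i \<noteq> j \<and> card (double_edge_model x i \<inter> double_edge_model x j) = 1))"
    unfolding edge_incidences_def sum.reindex_bij_betw[OF e, symmetric] by simp
  also have "\<dots> = [10, 8, 6] ! x"
    using assms(2) by (auto simp: double_edge_model_def eval_nat_numeral lessThan_Suc)
  finally show ?thesis .
qed

text \<open>Normals of disjoint edges are orthogonal, and so are those of parallel edges, which
  independence forces to have opposite signs. A single common end contributes exactly one nonzero
  term.\<close>

lemma Delta_family_inner_nonzero_iff:
  fixes g :: "'n::finite \<Rightarrow> real^'n"
  assumes fam: "is_family g" and g: "Delta_family g" and kl: "k \<noteq> l"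
  shows "g k \<bullet> g l \<noteq> 0 \<longleftrightarrow> card (fam_ends g k \<inter> fam_ends g l) = 1"
proof -
  obtain y z t c where k: "y \<noteq> z" "t = 1 \<or> t = -1" "c \<noteq> 0" "g k = c *\<^sub>R pm_root y t z" "fam_ends g k = {y, z}"
    by (rule Delta_familyE[OF g])
  have "g k \<bullet> g l = c * (g l $ y + t * g l $ z)"
    unfolding k(4) by (simp add: inner_commute[of _ "g l"] inner_pm_root)
  then have nz: "g k \<bullet> g l \<noteq> 0 \<longleftrightarrow> g l $ y + t * g l $ z \<noteq> 0" using k(3) by simp
  have mem: "m \<in> fam_ends g l \<longleftrightarrow> g l $ m \<noteq> 0" for m unfolding fam_ends_def by simp
  show ?thesis
  proof (cases "g l $ y = 0 \<or> g l $ z = 0")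
    case True
    then have "g k \<bullet> g l \<noteq> 0 \<longleftrightarrow> (y \<in> fam_ends g l \<longleftrightarrow> z \<notin> fam_ends g l)"
      unfolding nz mem using k(2) by auto
    also have "\<dots> \<longleftrightarrow> card (fam_ends g k \<inter> fam_ends g l) = 1"
      unfolding k(5) using k(1) by (cases "y \<in> fam_ends g l"; cases "z \<in> fam_ends g l") simp_all
    finally show ?thesis .
  next
    case False
    then have "{y, z} \<subseteq> fam_ends g l" unfolding fam_ends_def by simp
    then have l: "fam_ends g l = {y, z}"
      using Delta_family_card_ends[OF g, of l] k(1) card_subset_eq[of "fam_ends g l" "{y, z}"] by simp
    obtain t' c' where l': "t' = 1 \<or> t' = -1" "c' \<noteq> 0" "g l = c' *\<^sub>R pm_root y t' z"
      by (rule Delta_family_edge[OF g l k(1)])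
    have norm: "norm (g k) = 1" "norm (g l) = 1" using fam unfolding is_family_def by auto
    have "t' \<noteq> t"
    proof
      assume "t' = t"
      then have "g k = g l \<or> g k = - g l" using unit_scaleR_pm_eq[OF norm k(4)] l'(3) by blast
      then show False using is_family_pm_eq[OF fam] kl by blast
    qed
    then have "t * t' = -1" using k(2) l'(1) by auto
    moreover have "g l $ y = c'" "g l $ z = c' * t'"
      unfolding l'(3) pm_root_def using k(1) by (auto simp: axis_def)
    ultimately have "g k \<bullet> g l = 0" using nz by (simp add: mult.left_commute[of t])
    moreover have "card (fam_ends g k \<inter> fam_ends g l) = 2" unfolding k(5) l using k(1) by simp
    ultimately show ?thesis by simp
  qed
qed

lemma fam_isometric_edge_incidences:
  fixes g h :: "'n::finite \<Rightarrow> real^'n"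
  assumes g: "is_family g" "Delta_family g" and h: "is_family h" "Delta_family h" and iso: "fam_isometric g h"
  shows "edge_incidences (fam_ends g) = edge_incidences (fam_ends h)"
proof -
  obtain T where T: "orthogonal_transformation T" "T ` pm_set g = pm_set h"
    using iso unfolding fam_isometric_def by blast
  obtain \<tau> where \<tau>: "bij \<tau>" "\<And>k. T (g k) = h (\<tau> k) \<or> T (g k) = - h (\<tau> k)"
    using fam_isometric_bij[OF g(1) T] by metis
  have "(k \<noteq> l \<and> card (fam_ends g k \<inter> fam_ends g l) = 1)
      \<longleftrightarrow> (\<tau> k \<noteq> \<tau> l \<and> card (fam_ends h (\<tau> k) \<inter> fam_ends h (\<tau> l)) = 1)" for k l
  proof (cases "k = l")
    case False
    then have ne: "\<tau> k \<noteq> \<tau> l" using \<tau>(1) by (metis bij_pointE)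
    have "g k \<bullet> g l = T (g k) \<bullet> T (g l)" using T(1) unfolding orthogonal_transformation_def by simp
    then have "g k \<bullet> g l = h (\<tau> k) \<bullet> h (\<tau> l) \<or> g k \<bullet> g l = - (h (\<tau> k) \<bullet> h (\<tau> l))"
      using \<tau>(2)[of k] \<tau>(2)[of l] by auto
    then have "g k \<bullet> g l \<noteq> 0 \<longleftrightarrow> h (\<tau> k) \<bullet> h (\<tau> l) \<noteq> 0" by auto
    then show ?thesis
      unfolding Delta_family_inner_nonzero_iff[OF g False] Delta_family_inner_nonzero_iff[OF h ne]
      using False ne by blast
  qed simp
  then show ?thesis unfolding edge_incidences_def
    by (subst (3 4) sum.reindex_bij_betw[OF \<tau>(1), symmetric]) simp
qed

text \<open>Such a graph omits two of the six pairs of vertices. If they are disjoint, the rest is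
  the 4-cycle; if they share a vertex, it is the triangle with a pendant edge.\<close>

lemma simple_graph4_Gamma:
  fixes ends :: "'n::finite \<Rightarrow> 'n set"
  assumes card: "CARD('n) = 4" and two: "\<And>k. card (ends k) = 2" and inj: "inj ends"
  shows "is_Gamma1 UNIV ends \<or> is_Gamma2 UNIV ends"
proof -
  define K where "K = {B :: 'n set. card B = 2}"
  have "K = {B. B \<subseteq> UNIV \<and> card B = 2}" unfolding K_def by simp
  then have "card K = 4 choose 2" using n_subsets[of "UNIV :: 'n set" 2] card by simp
  then have K6: "card K = 6" by (simp add: choose_two)
  have sub: "range ends \<subseteq> K" unfolding K_def using two by auto
  have "card (range ends) = 4" using card_image[OF inj] card by simp
  then have "card (K - range ends) = 2" using K6 sub by (simp add: card_Diff_subset)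
  then obtain p q where pq: "K - range ends = {p, q}" "p \<noteq> q" by (meson card_2_iff)
  have pqK: "card p = 2" "card q = 2" using pq(1) unfolding K_def by blast+
  have rng: "range ends = K - {p, q}" using pq(1) sub by blast
  have K: "K = {{a, b}, {a, c}, {a, d}, {b, c}, {b, d}, {c, d}}"
    if "distinct [a, b, c, d]" "UNIV = {a, b, c, d}" for a b c d
  proof (rule equalityI; rule subsetI)
    fix B assume "B \<in> K"
    then obtain u w where uw: "B = {u, w}" "u \<noteq> w" unfolding K_def by (auto simp: card_2_iff)
    have "u = a \<or> u = b \<or> u = c \<or> u = d" "w = a \<or> w = b \<or> w = c \<or> w = d"
      by (rule UNIV4_cases[OF that(2)])+
    then show "B \<in> {{a, b}, {a, c}, {a, d}, {b, c}, {b, d}, {c, d}}"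
      using uw by (elim disjE) (auto simp: insert_commute)
  next
    fix B assume "B \<in> {{a, b}, {a, c}, {a, d}, {b, c}, {b, d}, {c, d}}"
    then show "B \<in> K" unfolding K_def using that(1) by auto
  qed
  show ?thesis
  proof (cases "p \<inter> q = {}")
    case True
    obtain a c where ac: "p = {a, c}" "a \<noteq> c" using pqK by (meson card_2_iff)
    obtain b d where bd: "q = {b, d}" "b \<noteq> d" using pqK by (meson card_2_iff)
    have dist: "distinct [a, b, c, d]" using ac bd True by auto
    then have "card {a, b, c, d} = CARD('n)" using card by simp
    then have U: "UNIV = {a, b, c, d}" using card_subset_eq[of UNIV "{a, b, c, d}"] by auto
    \<comment> \<open>The same inequalities in the opposite orientation, for simplifying equations
      between two-element sets.\<close>
    have dist': "distinct [d, c, b, a]" using dist by auto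
    have "range ends = {{a, b}, {a, d}, {b, c}, {c, d}}"
      unfolding rng K[OF dist U] ac bd using dist dist' by (simp add: insert_Diff_if doubleton_eq_iff)
    also have "\<dots> = {{a, b}, {b, c}, {c, d}, {d, a}}" by (simp add: insert_commute)
    finally have "is_Gamma2 UNIV ends" unfolding is_Gamma2_def
      using dist U inj by - (rule exI[of _ a], rule exI[of _ b], rule exI[of _ c], rule exI[of _ d], simp)
    then show ?thesis ..
  next
    case False
    then obtain d where d: "d \<in> p" "d \<in> q" by blast
    obtain a where a: "p = {d, a}" "d \<noteq> a" by (rule card_2_memberE[OF pqK(1) d(1)])
    obtain b where b: "q = {d, b}" "d \<noteq> b" by (rule card_2_memberE[OF pqK(2) d(2)])
    have "distinct [a, b, d]" using pq(2) a b by auto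
    then obtain c where c: "distinct [a, b, d, c]" "UNIV = {a, b, d, c}"
      by (rule UNIV4_obtain_last[OF card])
    have dist: "distinct [a, b, c, d]" using c(1) by auto
    have U: "UNIV = {a, b, c, d}" unfolding c(2) by (simp add: insert_commute)
    have dist': "distinct [d, c, b, a]" using dist by auto
    have "range ends = {{a, b}, {a, c}, {b, c}, {c, d}}"
      unfolding rng K[OF dist U] a b using dist dist' by (simp add: insert_Diff_if doubleton_eq_iff)
    also have "\<dots> = {{a, b}, {b, c}, {a, c}, {c, d}}" by (simp add: insert_commute)
    finally have "is_Gamma1 UNIV ends" unfolding is_Gamma1_def
      using dist U inj by - (rule exI[of _ a], rule exI[of _ b], rule exI[of _ c], rule exI[of _ d], simp)
    then show ?thesis ..
  qed
qed

text \<open>In dimension four the sign vector \<open>d\<close> has squared length 4. Its reflection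
  fixes the roots orthogonal to it and moves any other root to a root supported on the two
  complementary coordinates.\<close>

lemma reflect_sign_vector_pm_root:
  fixes d :: "real^'n::finite"
  assumes card: "CARD('n) = 4" and d: "\<And>m. d $ m = 1 \<or> d $ m = -1"
    and r: "y \<noteq> z" "t = 1 \<or> t = -1"
  shows "d $ y = - t * d $ z \<Longrightarrow> reflect d (c *\<^sub>R pm_root y t z) = c *\<^sub>R pm_root y t z"
    and "d $ y = t * d $ z \<Longrightarrow>
      reflect d (c *\<^sub>R pm_root y t z) $ m = (if m = y \<or> m = z then 0 else - c * d $ y * d $ m)"
proof -
  have in1: "(c *\<^sub>R pm_root y t z) \<bullet> d = c * (d $ y + t * d $ z)"
    by (simp add: inner_commute[of _ d] inner_pm_root)
  show "reflect d (c *\<^sub>R pm_root y t z) = c *\<^sub>R pm_root y t z" if "d $ y = - t * d $ z"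
    unfolding reflect_def in1 that by simp
  have sq: "d $ m * d $ m = 1" for m using d[of m] by auto
  have dd: "d \<bullet> d = 4" unfolding inner_vec_def inner_real_def sq using card by simp
  show "reflect d (c *\<^sub>R pm_root y t z) $ m = (if m = y \<or> m = z then 0 else - c * d $ y * d $ m)"
    if eq: "d $ y = t * d $ z"
  proof -
    have "d $ y + t * d $ z = 2 * d $ y" using eq by simp
    then have "reflect d (c *\<^sub>R pm_root y t z) $ m = c * (pm_root y t z $ m - d $ y * d $ m)"
      unfolding reflect_def in1 dd by (simp add: algebra_simps)
    moreover have "pm_root y t z $ m = (if m = y then 1 else if m = z then t else 0)"
      using r(1) by (auto simp: pm_root_def axis_def)
    moreover have "d $ y * d $ z = t" using eq sq[of z] by (simp add: mult.assoc)
    ultimately show ?thesis using sq[of y] by auto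
  qed
qed

text \<open>The outer automorphisms of \<open>D\<^sub>4\<close> are realized by reflections in vectors
  \<open>(\<plusminus>1, \<plusminus>1, \<plusminus>1, \<plusminus>1)\<close>, which replace some of the edges by the complementary edge.\<close>
lemma triality_merge_disjoint_edges:
  fixes g :: "'n::finite \<Rightarrow> real^'n"
  assumes card: "CARD('n) = 4" and fam: "is_family g" and g: "Delta_family g"
    and disj: "fam_ends g k \<inter> fam_ends g k' = {}"
  obtains h where "fam_isometric g h" "is_family h" "Delta_family h" "fam_ends h k = fam_ends h k'"
proof -
  obtain y z t c where k: "y \<noteq> z" "t = 1 \<or> t = -1" "c \<noteq> 0" "g k = c *\<^sub>R pm_root y t z" "fam_ends g k = {y, z}"
    by (rule Delta_familyE[OF g])
  obtain y' z' t' c' where k': "y' \<noteq> z'" "t' = 1 \<or> t' = -1" "c' \<noteq> 0" "g k' = c' *\<^sub>R pm_root y' t' z'"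
      "fam_ends g k' = {y', z'}"
    by (rule Delta_familyE[OF g])
  have dist: "distinct [y, z, y', z']" using disj k(1,5) k'(1,5) by auto
  \<comment> \<open>The signs make \<open>d\<close> orthogonal to the normal of \<open>k'\<close>
    but not to that of \<open>k\<close>. Thus \<open>k'\<close> stays in place and \<open>k\<close>
    moves to the complementary pair, which consists of the ends of \<open>k'\<close>.\<close>
  define d :: "real^'n" where "d = (\<chi> m. if m = z then t else if m = z' then - t' else 1)"
  have d: "d $ m = 1 \<or> d $ m = -1" for m unfolding d_def using k(2) k'(2) by auto
  note T = orthogonal_transformation_reflect[of d]
  define h where "h = reflect d \<circ> g"
  have iso: "fam_isometric g h"
    unfolding fam_isometric_def h_def using T pm_set_orthogonal_comp[OF T, of g] by metis
  have famh: "is_family h" unfolding h_def by (rule is_family_orthogonal_comp[OF T fam])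
  have "sqrt 2 *\<^sub>R h l \<in> Delta_D" for l
  proof -
    obtain a b s e where l: "a \<noteq> b" "s = 1 \<or> s = -1" "e \<noteq> 0" "g l = e *\<^sub>R pm_root a s b" "fam_ends g l = {a, b}"
      by (rule Delta_familyE[OF g])
    have gl: "sqrt 2 *\<^sub>R g l \<in> Delta_D" using g unfolding Delta_family_def by blast
    have ga: "g l $ a = e" unfolding l(4) pm_root_def using l(1) by (simp add: axis_def)
    have "\<bar>sqrt 2 * e\<bar> = 1" using Delta_D_component[OF gl, of a] l(3) ga by simp
    then have e: "\<bar>sqrt 2 * (e * u * w)\<bar> = 1" if "u = 1 \<or> u = -1" "w = 1 \<or> w = -1" for u w
      using that by (auto simp: abs_mult)
    \<comment> \<open>For any edge one of the two cases of the reflection formula applies, and in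
      both the image is again proportional to a root.\<close>
    have "d $ a = - s * d $ b \<or> d $ a = s * d $ b" using d[of a] d[of b] l(2) by auto
    then show ?thesis
    proof
      assume "d $ a = - s * d $ b"
      then have "h l = g l" unfolding h_def comp_def l(4)
        by (rule reflect_sign_vector_pm_root(1)[OF card d l(1,2)])
      then show ?thesis using gl by simp
    next
      assume "d $ a = s * d $ b"
      then have hl: "h l $ m = (if m = a \<or> m = b then 0 else - e * d $ a * d $ m)" for m
        unfolding h_def comp_def l(4) by (rule reflect_sign_vector_pm_root(2)[OF card d l(1,2)])
      obtain p q where pq: "distinct [a, b, p, q]" "UNIV = {a, b, p, q}"
        by (rule UNIV4_obtain_two[OF card l(1)])
      show ?thesis unfolding Delta_D_iff
      proof (rule exI[of _ p], rule exI[of _ q], intro conjI allI impI)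
        show "p \<noteq> q" using pq(1) by simp
        show "\<bar>(sqrt 2 *\<^sub>R h l) $ p\<bar> = 1" "\<bar>(sqrt 2 *\<^sub>R h l) $ q\<bar> = 1"
          using e[OF d[of a] d[of p]] e[OF d[of a] d[of q]] pq(1) by (auto simp: hl)
        fix m assume "m \<noteq> p" "m \<noteq> q"
        then show "(sqrt 2 *\<^sub>R h l) $ m = 0" using UNIV4_cases[OF pq(2), of m] by (simp add: hl)
      qed
    qed
  qed
  then have Dh: "Delta_family h" unfolding Delta_family_def by blast
  have "d $ y = t * d $ z" using k(2) dist unfolding d_def by auto
  then have "h k $ m = (if m = y \<or> m = z then 0 else - c * d $ y * d $ m)" for m
    unfolding h_def comp_def k(4) by (rule reflect_sign_vector_pm_root(2)[OF card d k(1,2)])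
  moreover have "d $ m \<noteq> 0" for m using d[of m] by auto
  ultimately have ek: "fam_ends h k = - {y, z}" unfolding fam_ends_def using k(3) by auto
  have "d $ y' = - t' * d $ z'" using k'(2) dist unfolding d_def by auto
  then have "h k' = g k'"
    unfolding h_def comp_def k'(4) by (rule reflect_sign_vector_pm_root(1)[OF card d k'(1,2)])
  then have "fam_ends h k' = {y', z'}" using k'(5) unfolding fam_ends_def by simp
  moreover have "- {y, z} = {y', z'}"
  proof (rule card_subset_eq[symmetric])
    show "{y', z'} \<subseteq> - {y, z}" using dist by auto
    show "card {y', z'} = card (- {y, z})" using dist card by (simp add: Compl_eq_Diff_UNIV card_Diff_subset)
  qed simp
  ultimately show thesis using that[OF iso famh Dh] ek by simp
qed

text \<open>In the chosen labellings both excluded graphs contain the perfect matching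
  \<open>{a, b}\<close>, \<open>{c, d}\<close>, the input for
  \<open>triality_merge_disjoint_edges\<close>.\<close>

lemma Gamma_disjoint_edges:
  fixes ends :: "'e \<Rightarrow> 'v::finite set"
  assumes "is_Gamma1 UNIV ends \<or> is_Gamma2 UNIV ends"
  obtains k k' where "CARD('v) = 4" "ends k \<inter> ends k' = {}"
proof -
  obtain a b c d where abcd: "distinct [a, b, c, d]" "UNIV = {a, b, c, d}"
    and "{a, b} \<in> range ends" "{c, d} \<in> range ends"
  proof -
    have "\<exists>a b c d. distinct [a, b, c, d] \<and> UNIV = {a, b, c, d} \<and> {a, b} \<in> range ends \<and> {c, d} \<in> range ends"
      using assms unfolding is_Gamma1_def is_Gamma2_def by (metis insertI1 insertI2)
    then show thesis using that by blast
  qed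
  then obtain k k' where "ends k = {a, b}" "ends k' = {c, d}" by (auto simp: image_iff)
  moreover have "CARD('v) = 4" unfolding abcd(2) using abcd(1) by simp
  ultimately show thesis using that[of k k'] abcd(1) by auto
qed

lemma mg_iso_ends:
  assumes "mg_iso E ends E' ends'" "finite E" "inj_on ends E"
  obtains \<sigma> where "bij \<sigma>" "finite E'" "inj_on ends' E'" "ends' ` E' = (`) \<sigma> ` ends ` E"
proof -
  obtain \<sigma> \<tau> where *: "bij \<sigma>" "bij_betw \<tau> E E'" "\<forall>e\<in>E. ends' (\<tau> e) = \<sigma> ` ends e"
    using assms(1) unfolding mg_iso_def by blast
  have E': "E' = \<tau> ` E" using *(2) unfolding bij_betw_def by simp
  have "ends' ` E' = (`) \<sigma> ` ends ` E" unfolding E' image_image using *(3) by (intro image_cong) auto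
  moreover have "inj_on ends' E'"
  proof (rule inj_onI)
    fix x y assume "x \<in> E'" "y \<in> E'" and eq: "ends' x = ends' y"
    then obtain e f where ef: "x = \<tau> e" "e \<in> E" "y = \<tau> f" "f \<in> E" unfolding E' by blast
    then have "\<sigma> ` ends e = \<sigma> ` ends f" using *(3) eq by simp
    then have "ends e = ends f" using *(1) by (simp add: bij_is_inj inj_image_eq_iff)
    then show "x = y" using assms(3) ef by (simp add: inj_on_eq_iff)
  qed
  ultimately show thesis using that[OF *(1)] assms(2) E' by simp
qed

lemma mg_iso_Gamma1:
  assumes iso: "mg_iso E ends E' ends'" and G: "is_Gamma1 E ends"
  shows "is_Gamma1 E' ends'"
proof -
  obtain a b c d where G: "distinct [a, b, c, d]" "UNIV = {a, b, c, d}" "finite E" "inj_on ends E"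
      "ends ` E = {{a, b}, {b, c}, {a, c}, {c, d}}"
    using G unfolding is_Gamma1_def by (elim exE conjE) (rule that)
  obtain \<sigma> where \<sigma>: "bij \<sigma>" "finite E'" "inj_on ends' E'" "ends' ` E' = (`) \<sigma> ` ends ` E"
    by (rule mg_iso_ends[OF iso G(3,4)])
  have "distinct (map \<sigma> [a, b, c, d])"
    unfolding distinct_map using G(1) inj_on_subset[OF bij_is_inj[OF \<sigma>(1)] subset_UNIV] by blast
  moreover have "UNIV = \<sigma> ` {a, b, c, d}" using \<sigma>(1) unfolding G(2)[symmetric] bij_def by simp
  ultimately show ?thesis unfolding is_Gamma1_def using \<sigma>(2-4) unfolding G(5)
    by - (rule exI[of _ "\<sigma> a"], rule exI[of _ "\<sigma> b"], rule exI[of _ "\<sigma> c"], rule exI[of _ "\<sigma> d"], simp)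
qed

lemma mg_iso_Gamma2:
  assumes iso: "mg_iso E ends E' ends'" and G: "is_Gamma2 E ends"
  shows "is_Gamma2 E' ends'"
proof -
  obtain a b c d where G: "distinct [a, b, c, d]" "UNIV = {a, b, c, d}" "finite E" "inj_on ends E"
      "ends ` E = {{a, b}, {b, c}, {c, d}, {d, a}}"
    using G unfolding is_Gamma2_def by (elim exE conjE) (rule that)
  obtain \<sigma> where \<sigma>: "bij \<sigma>" "finite E'" "inj_on ends' E'" "ends' ` E' = (`) \<sigma> ` ends ` E"
    by (rule mg_iso_ends[OF iso G(3,4)])
  have "distinct (map \<sigma> [a, b, c, d])"
    unfolding distinct_map using G(1) inj_on_subset[OF bij_is_inj[OF \<sigma>(1)] subset_UNIV] by blast
  moreover have "UNIV = \<sigma> ` {a, b, c, d}" using \<sigma>(1) unfolding G(2)[symmetric] bij_def by simp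
  ultimately show ?thesis unfolding is_Gamma2_def using \<sigma>(2-4) unfolding G(5)
    by - (rule exI[of _ "\<sigma> a"], rule exI[of _ "\<sigma> b"], rule exI[of _ "\<sigma> c"], rule exI[of _ "\<sigma> d"], simp)
qed

text \<open>An isometry need not permute the axes here. Instead the three models with a double edge
  are told apart by the invariant \<open>edge_incidences\<close>.\<close>

lemma fam_isometric_imp_mg_iso_4:
  fixes g h :: "'n::finite \<Rightarrow> real^'n"
  assumes card: "CARD('n) = 4"
    and g: "is_family g" "Delta_family g" "connected_mg UNIV (fam_ends g)" "\<not> inj (fam_ends g)"
    and h: "is_family h" "Delta_family h" "connected_mg UNIV (fam_ends h)" "\<not> inj (fam_ends h)"
    and iso: "fam_isometric g h"
  shows "mg_iso UNIV (fam_ends g) UNIV (fam_ends h)"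
proof -
  obtain x where x: "x \<in> {0, 1, 2}" "modelled (fam_ends g) (double_edge_model x)"
    by (rule double_edge_classification[OF card Delta_family_loopless[OF g(2)] g(3,4)])
  obtain x' where x': "x' \<in> {0, 1, 2}" "modelled (fam_ends h) (double_edge_model x')"
    by (rule double_edge_classification[OF card Delta_family_loopless[OF h(2)] h(3,4)])
  have "[10, 8, 6 :: nat] ! x = [10, 8, 6] ! x'"
    using fam_isometric_edge_incidences[OF g(1,2) h(1,2) iso]
    unfolding edge_incidences_double_edge_model[OF x(2,1)] edge_incidences_double_edge_model[OF x'(2,1)] .
  then have "x = x'" using x(1) x'(1) by auto
  then show ?thesis using modelled_imp_mg_iso x(2) x'(2) by blast
qed

text \<open>The bijection between classes is expressed through the relation
  \<open>corresponds\<close>: existence in both directions, then uniqueness in both directions. The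
  graph found for a family has the indices of the normals as its edges.\<close>

theorem theorem3:
  fixes dummy :: "'n::finite itself"
  assumes "CARD('n) \<ge> 4"
  shows
    "(\<forall>(E :: 'e set) ends. in_M' E ends \<longrightarrow>
        (\<exists>(f :: 'n \<Rightarrow> real^'n). generates_D f \<and> corresponds f E ends))
     \<and> (\<forall>(f :: 'n \<Rightarrow> real^'n). generates_D f \<longrightarrow>
        (\<exists>(E :: 'n set) ends. in_M' E ends \<and> corresponds f E ends))
     \<and> (\<forall>(f :: 'n \<Rightarrow> real^'n) (E :: 'e set) ends (E' :: 'f set) ends'.
        generates_D f \<and> in_M' E ends \<and> in_M' E' ends' \<and>
        corresponds f E ends \<and> corresponds f E' ends' \<longrightarrow> mg_iso E ends E' ends')
     \<and> (\<forall>(f :: 'n \<Rightarrow> real^'n) g (E :: 'e set) ends.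
        generates_D f \<and> generates_D g \<and> in_M' E ends \<and>
        corresponds f E ends \<and> corresponds g E ends \<longrightarrow> fam_isometric f g)"
proof (intro conjI allI impI)
  fix E :: "'e set" and ends :: "'e \<Rightarrow> 'n set"
  assume "in_M' E ends"
  then have "in_M E ends" unfolding in_M'_def by blast
  then obtain g :: "'n \<Rightarrow> real^'n" where g: "is_family g" "Delta_family g"
      "connected_mg UNIV (fam_ends g)" "mg_iso UNIV (fam_ends g) E ends"
    by (rule ex_Delta_family)
  \<comment> \<open>The normals of \<open>g\<close> already lie along roots, so the conjugating
    isometry is the identity.\<close>
  have "W_D = (\<lambda>w. id \<circ> w \<circ> inv id) ` refl_group (range g)"
    unfolding connected_imp_refl_group_W_D[OF g(1-3)] by simp
  moreover have "orthogonal_transformation (id :: real^'n \<Rightarrow> real^'n)"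
    unfolding id_def by (rule orthogonal_transformation_id)
  ultimately have "generates_D g" unfolding generates_D_def using g(1) by blast
  moreover have "corresponds g E ends" unfolding corresponds_def using g fam_isometric_refl by blast
  ultimately show "\<exists>f :: 'n \<Rightarrow> real^'n. generates_D f \<and> corresponds f E ends" by blast
next
  fix f :: "'n \<Rightarrow> real^'n"
  assume f: "generates_D f"
  have witness: "\<exists>(E :: 'n set) ends. in_M' E ends \<and> corresponds f E ends"
    if h: "fam_isometric f h" "is_family h" "Delta_family h"
      and G: "\<not> is_Gamma1 UNIV (fam_ends h)" "\<not> is_Gamma2 UNIV (fam_ends h)" for h
  proof -
    have "connected_mg UNIV (fam_ends h)"
      using refl_group_W_D_imp_connected[OF h(3)] generates_D_Delta_family_refl_group[OF f h(1,3)] by blast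
    then have "in_M' UNIV (fam_ends h)"
      unfolding in_M'_def in_M_iff using G Delta_family_loopless[OF h(3)] by blast
    moreover have "mg_iso UNIV (fam_ends h) UNIV (fam_ends h)"
      unfolding mg_iso_def by (rule exI[of _ id], rule exI[of _ id]) simp
    ultimately show ?thesis unfolding corresponds_def using h by blast
  qed
  obtain g where g: "fam_isometric f g" "is_family g" "Delta_family g"
    by (rule generates_D_ex_Delta_family[OF f])
  show "\<exists>(E :: 'n set) ends. in_M' E ends \<and> corresponds f E ends"
  \<comment> \<open>A family realizing an excluded graph is moved by triality to one with a double
    edge, whereas both excluded graphs are simple.\<close>
  proof (cases "is_Gamma1 UNIV (fam_ends g) \<or> is_Gamma2 UNIV (fam_ends g)")
    case True
    then obtain k k' where k: "CARD('n) = 4" "fam_ends g k \<inter> fam_ends g k' = {}"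
      by (rule Gamma_disjoint_edges)
    obtain h where h: "fam_isometric g h" "is_family h" "Delta_family h" "fam_ends h k = fam_ends h k'"
      by (rule triality_merge_disjoint_edges[OF k(1) g(2,3) k(2)])
    have "k \<noteq> k'" using k(2) Delta_family_card_ends[OF g(3), of k] by auto
    then have "\<not> inj (fam_ends h)" using h(4) by (auto dest: injD)
    then show ?thesis
      using witness[OF fam_isometric_trans[OF g(1) h(1)] h(2,3)] unfolding is_Gamma1_def is_Gamma2_def by blast
  next
    case False
    then show ?thesis using witness[OF g] by blast
  qed
next
  fix f :: "'n \<Rightarrow> real^'n" and E :: "'e set" and ends and E' :: "'f set" and ends'
  assume *: "generates_D f \<and> in_M' E ends \<and> in_M' E' ends' \<and> corresponds f E ends \<and> corresponds f E' ends'"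
  then have f: "generates_D f" by blast
  obtain g where g: "fam_isometric f g" "is_family g" "Delta_family g" "mg_iso UNIV (fam_ends g) E ends"
    using * unfolding corresponds_def by blast
  obtain h where h: "fam_isometric f h" "is_family h" "Delta_family h" "mg_iso UNIV (fam_ends h) E' ends'"
    using * unfolding corresponds_def by blast
  note Wg = generates_D_Delta_family_refl_group[OF f g(1,3)]
  note Wh = generates_D_Delta_family_refl_group[OF f h(1,3)]
  have iso: "fam_isometric g h" by (rule fam_isometric_trans[OF fam_isometric_sym[OF g(1)] h(1)])
  have "mg_iso UNIV (fam_ends g) UNIV (fam_ends h)"
  proof (cases "CARD('n) = 4")
    case True
    \<comment> \<open>A simple graph would be one of the two excluded ones, and the isomorphism
      would carry this over to \<open>E\<close>.\<close>
    have "\<not> inj (fam_ends g)"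
    proof
      assume "inj (fam_ends g)"
      then have "is_Gamma1 UNIV (fam_ends g) \<or> is_Gamma2 UNIV (fam_ends g)"
        by (rule simple_graph4_Gamma[OF True Delta_family_card_ends[OF g(3)]])
      then have "is_Gamma1 E ends \<or> is_Gamma2 E ends"
        using mg_iso_Gamma1[OF g(4)] mg_iso_Gamma2[OF g(4)] by blast
      then show False using * unfolding in_M'_def by blast
    qed
    moreover have "\<not> inj (fam_ends h)"
    proof
      assume "inj (fam_ends h)"
      then have "is_Gamma1 UNIV (fam_ends h) \<or> is_Gamma2 UNIV (fam_ends h)"
        by (rule simple_graph4_Gamma[OF True Delta_family_card_ends[OF h(3)]])
      then have "is_Gamma1 E' ends' \<or> is_Gamma2 E' ends'"
        using mg_iso_Gamma1[OF h(4)] mg_iso_Gamma2[OF h(4)] by blast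
      then show False using * unfolding in_M'_def by blast
    qed
    ultimately show ?thesis
      using refl_group_W_D_imp_connected[OF g(3) Wg] refl_group_W_D_imp_connected[OF h(3) Wh]
      by (intro fam_isometric_imp_mg_iso_4[OF True g(2,3) _ _ h(2,3) _ _ iso])
  next
    case False
    then have "CARD('n) \<ge> 5" using assms by simp
    then show ?thesis by (rule fam_isometric_imp_mg_iso_ge5[OF _ g(2) Wg Wh iso])
  qed
  then show "mg_iso E ends E' ends'" by (intro mg_iso_trans[OF mg_iso_trans[OF mg_iso_sym[OF g(4)] _] h(4)])
next
  fix f g :: "'n \<Rightarrow> real^'n" and E :: "'e set" and ends
  assume *: "generates_D f \<and> generates_D g \<and> in_M' E ends \<and> corresponds f E ends \<and> corresponds g E ends"
  then have fg: "generates_D f" "generates_D g" by blast+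
  obtain f' where f': "fam_isometric f f'" "is_family f'" "Delta_family f'" "mg_iso UNIV (fam_ends f') E ends"
    using * unfolding corresponds_def by blast
  obtain g' where g': "fam_isometric g g'" "is_family g'" "Delta_family g'" "mg_iso UNIV (fam_ends g') E ends"
    using * unfolding corresponds_def by blast
  have "connected_mg UNIV (fam_ends f')"
    by (rule refl_group_W_D_imp_connected[OF f'(3) generates_D_Delta_family_refl_group[OF fg(1) f'(1,3)]])
  moreover have "mg_iso UNIV (fam_ends f') UNIV (fam_ends g')"
    by (rule mg_iso_trans[OF f'(4) mg_iso_sym[OF g'(4)]])
  ultimately have "fam_isometric f' g'" by (rule mg_iso_imp_fam_isometric[OF f'(2,3) g'(2,3)])
  then show "fam_isometric f g"
    by (intro fam_isometric_trans[OF fam_isometric_trans[OF f'(1) _] fam_isometric_sym[OF g'(1)]])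
qed

end
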